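(* Let $p_o>0$ and, for $0<\delta\le p_o$, let $\Delta_\delta$ and $f^\delta_{p_o}$ be as in the context (satisfying conditions (i)–(v)), and $f^\delta_{p_o,y_o}(y)=f^\delta_{p_o}(y-y_o)$. Then for every such $\delta$, \[ \lim_{y_o\to+\infty}\Big(\bar N[f^\delta_{p_o,y_o}]-\bar N^{Th}_{2\pi}[f^\delta_{p_o,y_o}]\Big)=0,\qquad \lim_{y_o\to-\infty}\bar N[f^\delta_{p_o,y_o}]=0,\] and consequently, for a family $(\Delta_\delta)_{0<\delta\le p_o}$ of such functions, \[ \lim_{\delta\to0}\lim_{y_o\to+\infty}\Big(\bar N[f^\delta_{p_o,y_o}]-\bar N^{Th}_{2\pi}[f^\delta_{p_o,y_o}]\Big)=0,\qquad \lim_{\delta\to0}\lim_{y_o\to-\infty}\bar N[f^\delta_{p_o,y_o}]=0.\]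
   Context: Fourier transforms: $\tilde g(p)=(2\pi)^{-1/2}\int g(y)e^{-ipy}dy$; $\theta$ is the Heaviside step function. Wave packet: fix $p_o\ge\delta>0$, let $\Delta_\delta:\mathbb R\to\mathbb R$ and define $f^\delta_{p_o}$ by $\tilde f^\delta_{p_o}(p)=\theta(p)\sqrt{2|p|}\,\Delta_\delta(p-p_o)$, with: (i) $\int_{\mathbb R}|\Delta_\delta(p)|^2dp=1$; (ii) the support of $\Delta_\delta$ is contained in $(-\delta,\delta)$; (iii) $\tilde f^\delta_{p_o}\in C^r(\mathbb R)$ for some $r\ge0$, its derivatives of order $0,\dots,r$ vanish at the origin and at infinity, the derivative of order $r+1$ exists almost everywhere and is bounded, and the derivative of order $r+2$ exists almost everywhere and is integrable; (iv) $\Delta_\delta$ is real and nonnegative; (v) $f^\delta_{p_o}$ and its derivative are integrable. Then $\tilde f^\delta_{p_o}$ is normalised: $\int_0^\infty\frac{dp}{2p}|\tilde f^\delta_{p_o}(p)|^2=1$. With $x(y)=-\log(1+e^{-y})$: $\widetilde{\check f}(-k)=(2\pi)^{-1/2}\int_{\mathbb R} f(y)e^{ikx(y)}dy$, $\bar N[f]=\int_0^\infty\frac{dk}{2k}|\widetilde{\check f}(-k)|^2$, and $\bar N^{Th}_{2\pi}[f]=\int_0^\infty\frac{dp}{2p}\frac{|\tilde f(p)|^2}{e^{2\pi p}-1}$. *)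

theory Defs
  imports "HOL-Analysis.Analysis"
begin

definition fourier :: "(real \<Rightarrow> complex) \<Rightarrow> real \<Rightarrow> complex" where
  "fourier g p = complex_of_real (1 / sqrt (2 * pi)) * (LINT y|lborel. g y * cis (- p * y))"

definition ftil :: "real \<Rightarrow> (real \<Rightarrow> real) \<Rightarrow> real \<Rightarrow> real" where
  "ftil po D p = (if p > 0 then sqrt (2 * \<bar>p\<bar>) * D (p - po) else 0)"

definition wave :: "real \<Rightarrow> (real \<Rightarrow> real) \<Rightarrow> real \<Rightarrow> complex" where
  "wave po D y = complex_of_real (1 / sqrt (2 * pi)) *
      (LINT p|lborel. complex_of_real (ftil po D p) * cis (p * y))"

definition wave_shift :: "real \<Rightarrow> (real \<Rightarrow> real) \<Rightarrow> real \<Rightarrow> real \<Rightarrow> complex" where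
  "wave_shift po D yo y = wave po D (y - yo)"

definition xmap :: "real \<Rightarrow> real" where
  "xmap y = - ln (1 + exp (- y))"

text \<open>checkft f k  is  \widetilde{\check f}(-k) = (2 pi)^(-1/2) int f(y) e^(i k x(y)) dy.\<close>
definition checkft :: "(real \<Rightarrow> complex) \<Rightarrow> real \<Rightarrow> complex" where
  "checkft f k = complex_of_real (1 / sqrt (2 * pi)) * (LINT y|lborel. f y * cis (k * xmap y))"

definition Nbar :: "(real \<Rightarrow> complex) \<Rightarrow> real" where
  "Nbar f = (LBINT k:{0<..}. (cmod (checkft f k))\<^sup>2 / (2 * k))"

definition NTh2pi :: "(real \<Rightarrow> complex) \<Rightarrow> real" where
  "NTh2pi f = (LBINT p:{0<..}. (cmod (fourier f p))\<^sup>2 / (2 * p) / (exp (2 * pi * p) - 1))"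

definition admissible :: "real \<Rightarrow> real \<Rightarrow> (real \<Rightarrow> real) \<Rightarrow> bool" where
  "admissible po \<delta> D \<longleftrightarrow>
     \<comment> \<open>(i)\<close>
     integrable lborel (\<lambda>p. (D p)\<^sup>2) \<and> (LINT p|lborel. (D p)\<^sup>2) = 1 \<and>
     \<comment> \<open>(ii)\<close>
     closure {p. D p \<noteq> 0} \<subseteq> {-\<delta><..<\<delta>} \<and>
     \<comment> \<open>(iii)\<close>
     (let F = ftil po D in
       \<exists>r::nat.
         (\<forall>k\<le>r. continuous_on UNIV ((deriv ^^ k) F)) \<and>
         (\<forall>k<r. \<forall>x. (deriv ^^ k) F differentiable (at x)) \<and>
         (\<forall>k\<le>r. (deriv ^^ k) F 0 = 0 \<and>
                  ((deriv ^^ k) F \<longlongrightarrow> 0) at_top \<and> ((deriv ^^ k) F \<longlongrightarrow> 0) at_bot) \<and>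
         (AE x in lborel. (deriv ^^ r) F differentiable (at x)) \<and>
         (\<exists>B. \<forall>x. (deriv ^^ r) F differentiable (at x) \<longrightarrow> \<bar>(deriv ^^ Suc r) F x\<bar> \<le> B) \<and>
         (AE x in lborel. (deriv ^^ Suc r) F differentiable (at x)) \<and>
         integrable lborel (\<lambda>x. if (deriv ^^ Suc r) F differentiable (at x)
                                  then (deriv ^^ Suc (Suc r)) F x else 0)) \<and>
     \<comment> \<open>(iv)\<close>
     (\<forall>p. 0 \<le> D p) \<and>
     \<comment> \<open>(v)\<close>
     integrable lborel (wave po D) \<and>
     (\<forall>y. wave po D differentiable (at y)) \<and>
     integrable lborel (\<lambda>y. vector_derivative (wave po D) (at y))"

end

theory Submission
  imports Defs "HOL-Probability.Probability" "HOL-Real_Asymp.Real_Asymp"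
begin

text \<open>
  Write \<open>f = f\<^sub>p\<^sub>o\<close> as an inverse Fourier integral of its spectrum \<open>F\<close>, which is continuous and supported
  in some \<open>[a, b]\<close> with \<open>a > 0\<close>. The substitution \<open>t = exp x(y)\<close> turns the plane wave \<open>exp (i p y)\<close> into a Beta
  integrand, so that the transform of the shifted packet is
  \<open>1/(2 \<pi>) \<integral> F(p) exp (- i p y\<^sub>o) A(p, k) dp\<close> with \<open>A(p, k) = \<Gamma>(- i p) \<Gamma>(i (k + p)) / \<Gamma>(i k)\<close>.
  For large \<open>k\<close>, \<open>A(p, k) = \<Gamma>(- i p) L(p) exp (i p ln k) + O(1/k)\<close> with \<open>|L(p)|\<^sup>2 = exp (- \<pi> p)\<close>, and
  \<open>|A(p, k)|\<^sup>2 = O(k)\<close> for small \<open>k\<close>. Up to an error that vanishes by dominated convergence and the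
  Riemann-Lebesgue lemma, the number of particles is therefore the integral over \<open>s > - y\<^sub>o\<close> of a fixed function
  \<open>|m(s)|\<^sup>2\<close>, where \<open>s = ln k - y\<^sub>o\<close>. It tends to \<open>0\<close> as \<open>y\<^sub>o \<rightarrow> -\<infinity>\<close>, and to the thermal value by Plancherel's
  theorem as \<open>y\<^sub>o \<rightarrow> \<infinity>\<close>, because \<open>|\<Gamma>(i p)|\<^sup>2 = \<pi> / (p sinh (\<pi> p))\<close>.
\<close>

subsection \<open>Fourier integrals of continuous functions with Gaussian summation\<close>

lemma integrable_product_kernel:
  fixes g h :: "real \<Rightarrow> complex" and K :: "real \<Rightarrow> real \<Rightarrow> complex"
  assumes g: "integrable lborel g" and h: "integrable lborel h"
    and K[measurable]: "(\<lambda>(x, y). K x y) \<in> borel_measurable (borel \<Otimes>\<^sub>M borel)"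
    and C: "\<And>x y. norm (K x y) \<le> C"
  shows "integrable (lborel \<Otimes>\<^sub>M lborel) (\<lambda>(x, y). g x * h y * K x y)"
proof -
  note [measurable] = borel_measurable_integrable[OF g] borel_measurable_integrable[OF h]
  have "integrable (lborel \<Otimes>\<^sub>M lborel) (\<lambda>(x, y). g x * h y)"
  proof (rule lborel_pair.Fubini_integrable)
    show "integrable lborel (\<lambda>x. LINT y|lborel. norm (case (x, y) of (x, y) \<Rightarrow> g x * h y))"
      using g by (simp add: norm_mult)
    show "AE x in lborel. integrable lborel (\<lambda>y. case (x, y) of (x, y) \<Rightarrow> g x * h y)"
      using h by simp
  qed simp
  then have "integrable (lborel \<Otimes>\<^sub>M lborel) (\<lambda>z. C *\<^sub>R (case z of (x, y) \<Rightarrow> g x * h y))"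
    by (rule integrable_scaleR_right)
  then show ?thesis
  proof (rule Bochner_Integration.integrable_bound)
    show "AE z in lborel \<Otimes>\<^sub>M lborel. norm (case z of (x, y) \<Rightarrow> g x * h y * K x y)
        \<le> norm (C *\<^sub>R (case z of (x, y) \<Rightarrow> g x * h y))"
    proof (rule AE_I2, clarify)
      fix x y
      have "norm (K x y) \<le> \<bar>C\<bar>" using C[of x y] by linarith
      then show "norm (g x * h y * K x y) \<le> norm (C *\<^sub>R (g x * h y))"
        by (simp add: norm_mult mult.commute mult_right_mono)
    qed
  qed simp
qed

text \<open>A bounded kernel leaves the product of two integrable functions integrable on the plane,
  so Fubini applies. The exchanges below that involve a Fourier kernel are instances with C =
  1.\<close>

lemma integral_swap_kernel:
  fixes g h :: "real \<Rightarrow> complex" and K :: "real \<Rightarrow> real \<Rightarrow> complex"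
  assumes "integrable lborel g" and "integrable lborel h"
    and "(\<lambda>(x, y). K x y) \<in> borel_measurable (borel \<Otimes>\<^sub>M borel)"
    and "\<And>x y. norm (K x y) \<le> C"
  shows "(LINT x|lborel. g x * (LINT y|lborel. h y * K x y)) =
         (LINT y|lborel. h y * (LINT x|lborel. g x * K x y))"
proof -
  have "(LINT y|lborel. LINT x|lborel. (\<lambda>(x, y). g x * h y * K x y) (x, y)) =
        (LINT x|lborel. LINT y|lborel. (\<lambda>(x, y). g x * h y * K x y) (x, y))"
    by (rule lborel_pair.Fubini_integral) (use integrable_product_kernel[OF assms] in simp)
  moreover have "(LINT x|lborel. g x * h y * K x y) = h y * (LINT x|lborel. g x * K x y)" for y
    by (subst integral_mult_right_zero[symmetric]) (simp add: mult_ac)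
  moreover have "(LINT y|lborel. g x * h y * K x y) = g x * (LINT y|lborel. h y * K x y)" for x
    by (subst integral_mult_right_zero[symmetric]) (simp add: mult_ac)
  ultimately show ?thesis by simp
qed

lemma borel_measurable_cis[measurable (raw)]:
  "f \<in> borel_measurable M \<Longrightarrow> (\<lambda>x. cis (f x)) \<in> borel_measurable M"
  by (erule measurable_compose) (auto intro!: borel_measurable_continuous_onI continuous_intros)

lemma borel_measurable_cnj[measurable (raw)]:
  "f \<in> borel_measurable M \<Longrightarrow> (\<lambda>x. cnj (f x)) \<in> borel_measurable M"
  by (erule measurable_compose) (auto intro!: borel_measurable_continuous_onI continuous_intros)

lemma integrable_gaussian:
  assumes "\<sigma> > 0"
  shows "integrable lborel (\<lambda>y. complex_of_real (exp (- (\<sigma> * y)\<^sup>2 / 2)))"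
proof -
  have "integrable lborel (\<lambda>y. sqrt (2 * pi) * std_normal_density y)"
    by (intro integrable_mult_right) simp
  then have "integrable lborel (\<lambda>y::real. exp (- y\<^sup>2 / 2))"
    by (simp add: std_normal_density_def)
  from lborel_integrable_real_affine[OF this, of \<sigma> 0] assms show ?thesis
    by (intro integrable_of_real) simp
qed

text \<open>This is the characteristic function of the standard normal distribution at
  \<open>u / \<sigma>\<close>, after rescaling by \<sigma>. Damping by a wide Gaussian thus becomes
  convolution with a narrow normal density.\<close>

lemma gaussian_fourier:
  assumes "\<sigma> > 0"
  shows "(LINT y|lborel. complex_of_real (exp (- (\<sigma> * y)\<^sup>2 / 2)) * cis (u * y)) =
         complex_of_real (2 * pi * normal_density 0 \<sigma> u)"
proof -
  define c where "c = complex_of_real (sqrt (2 * pi))"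
  have [simp]: "c \<noteq> 0" by (simp add: c_def)
  have "complex_of_real (exp (- ((u / \<sigma>)\<^sup>2) / 2)) = char std_normal_distribution (u / \<sigma>)"
    by (simp add: char_std_normal_distribution)
  also have "\<dots> = (LINT x|lborel. complex_of_real (std_normal_density x) * cis (u / \<sigma> * x))"
    unfolding char_def by (subst integral_density) (auto simp: cis_conv_exp scaleR_conv_of_real)
  also have "\<dots> = \<sigma> *\<^sub>R (LINT y|lborel. complex_of_real (std_normal_density (\<sigma> * y)) * cis (u * y))"
    using assms by (subst lborel_integral_real_affine[of \<sigma> _ 0]) auto
  also have "(\<lambda>y. complex_of_real (std_normal_density (\<sigma> * y)) * cis (u * y)) =
      (\<lambda>y. inverse c * (complex_of_real (exp (- (\<sigma> * y)\<^sup>2 / 2)) * cis (u * y)))"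
    by (simp add: std_normal_density_def c_def field_simps)
  also have "(LINT y|lborel. inverse c * (complex_of_real (exp (- (\<sigma> * y)\<^sup>2 / 2)) * cis (u * y))) =
      inverse c * (LINT y|lborel. complex_of_real (exp (- (\<sigma> * y)\<^sup>2 / 2)) * cis (u * y))"
    by simp
  finally have "(LINT y|lborel. complex_of_real (exp (- (\<sigma> * y)\<^sup>2 / 2)) * cis (u * y)) =
      c / \<sigma> * complex_of_real (exp (- ((u / \<sigma>)\<^sup>2) / 2))"
    using assms by (simp add: field_simps scaleR_conv_of_real)
  also have "\<dots> = complex_of_real (sqrt (2 * pi) / \<sigma> * exp (- ((u / \<sigma>)\<^sup>2) / 2))"
    by (simp add: c_def)
  also have "sqrt (2 * pi) / \<sigma> * exp (- ((u / \<sigma>)\<^sup>2) / 2) = 2 * pi * normal_density 0 \<sigma> u"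
  proof -
    have "2 * pi = sqrt (2 * pi) * sqrt (2 * pi)" by simp
    then show ?thesis using assms
      by (simp add: normal_density_def real_sqrt_mult power_divide field_simps)
  qed
  finally show ?thesis .
qed

text \<open>The substitution q = p + v / (n + 1) moves the parameter from the density into the
  argument of \<open>F\<close>, where continuity and dominated convergence apply. The bound, uniform
  in n and p, later supplies a majorant for Plancherel's theorem.\<close>

lemma gaussian_approximate_identity:
  fixes F :: "real \<Rightarrow> complex"
  assumes cont: "continuous_on UNIV F" and B: "\<And>x. norm (F x) \<le> B"
  shows "(\<lambda>n. LINT q|lborel. F q * complex_of_real (normal_density 0 (1 / real (Suc n)) (q - p)))
           \<longlonglongrightarrow> F p"
    and "\<And>n. norm (LINT q|lborel. F q * complex_of_real (normal_density 0 (1 / real (Suc n)) (q - p))) \<le> B"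
proof -
  have [measurable]: "F \<in> borel_measurable borel"
    using cont by (rule borel_measurable_continuous_onI)
  let ?s = "\<lambda>n. 1 / real (Suc n)"
  have eq: "(LINT q|lborel. F q * complex_of_real (normal_density 0 (?s n) (q - p))) =
        (LINT v|lborel. F (p + ?s n * v) * complex_of_real (std_normal_density v))" (is "?l = ?r") for n
  proof -
    have "?l = ?s n *\<^sub>R (LINT v|lborel. F (p + ?s n * v) * complex_of_real (normal_density 0 (?s n) (?s n * v)))"
      by (subst lborel_integral_real_affine[of "?s n" _ p]) auto
    also have "\<dots> = (LINT v|lborel. ?s n *\<^sub>R (F (p + ?s n * v) * complex_of_real (normal_density 0 (?s n) (?s n * v))))"
      by (rule integral_scaleR_right[symmetric]) 
    also have "\<dots> = ?r"
    proof (intro Bochner_Integration.integral_cong refl)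
      fix v
      have "normal_density 0 s (s * v) = std_normal_density v / s" if "s > 0" for s :: real
        using that by (simp add: normal_density_def real_sqrt_mult power_mult_distrib)
      from this[of "?s n"] have "?s n * normal_density 0 (?s n) (?s n * v) = std_normal_density v"
        by simp
      from arg_cong[OF this, of complex_of_real]
      show "?s n *\<^sub>R (F (p + ?s n * v) * complex_of_real (normal_density 0 (?s n) (?s n * v))) =
          F (p + ?s n * v) * complex_of_real (std_normal_density v)"
        by (simp only: scaleR_conv_of_real of_real_mult mult.left_commute[of _ "F _"])
    qed
    finally show ?thesis .
  qed
  have std: "integrable lborel std_normal_density" "(LINT v|lborel. std_normal_density v) = 1"
    using prob_space_normal_density[of 1 0] by (auto simp: integral_normal_density)
  have "(\<lambda>n. LINT v|lborel. F (p + ?s n * v) * complex_of_real (std_normal_density v))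
     \<longlonglongrightarrow> (LINT v|lborel. F p * complex_of_real (std_normal_density v))"
  proof (rule integral_dominated_convergence[where w="\<lambda>v. B * std_normal_density v"])
    show "AE v in lborel. (\<lambda>n. F (p + ?s n * v) * complex_of_real (std_normal_density v))
       \<longlonglongrightarrow> F p * complex_of_real (std_normal_density v)"
    proof (rule AE_I2)
      fix v
      have "(\<lambda>n. ?s n) \<longlonglongrightarrow> 0" using LIMSEQ_inverse_real_of_nat by (simp add: inverse_eq_divide)
      then have "(\<lambda>n. p + ?s n * v) \<longlonglongrightarrow> p + 0 * v" by (intro tendsto_intros)
      moreover have "isCont F p" using cont by (simp add: continuous_on_eq_continuous_at)
      ultimately have "(\<lambda>n. F (p + ?s n * v)) \<longlonglongrightarrow> F p" by (intro isCont_tendsto_compose[of p F]) auto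
      then show "(\<lambda>n. F (p + ?s n * v) * complex_of_real (std_normal_density v))
       \<longlonglongrightarrow> F p * complex_of_real (std_normal_density v)" by (intro tendsto_intros)
    qed
    show "AE v in lborel. norm (F (p + ?s n * v) * complex_of_real (std_normal_density v))
         \<le> B * std_normal_density v" for n
      using B by (intro AE_I2) (auto simp: norm_mult intro!: mult_right_mono)
  qed (use std in auto)
  also have "(LINT v|lborel. F p * complex_of_real (std_normal_density v)) = F p"
    using std by simp
  finally show "(\<lambda>n. LINT q|lborel. F q * complex_of_real (normal_density 0 (?s n) (q - p))) \<longlonglongrightarrow> F p"
    unfolding eq .
  fix n
  have "norm (LINT v|lborel. F (p + ?s n * v) * complex_of_real (std_normal_density v))
      \<le> (LINT v|lborel. B * std_normal_density v)"
  proof (rule order_trans[OF integral_norm_bound], rule integral_mono')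
    have "0 \<le> B" using B[of 0] norm_ge_zero order_trans by blast
    then show "0 \<le> B * std_normal_density v" for v by simp
  qed (use std B in \<open>auto simp: norm_mult intro!: mult_right_mono\<close>)
  then show "norm (LINT q|lborel. F q * complex_of_real (normal_density 0 (?s n) (q - p))) \<le> B"
    unfolding eq using std by simp
qed


lemma gaussian_summation:
  fixes F :: "real \<Rightarrow> complex"
  assumes cont: "continuous_on UNIV F" and B: "\<And>x. norm (F x) \<le> B"
  shows "(\<lambda>n. LINT q|lborel. F q *
            (LINT y|lborel. complex_of_real (exp (- (1 / real (Suc n) * y)\<^sup>2 / 2)) * cis ((q - p) * y)))
           \<longlonglongrightarrow> 2 * pi * F p"
    and "\<And>n. norm (LINT q|lborel. F q *
            (LINT y|lborel. complex_of_real (exp (- (1 / real (Suc n) * y)\<^sup>2 / 2)) * cis ((q - p) * y)))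
           \<le> 2 * pi * B"
proof -
  have eq: "(LINT q|lborel. F q *
            (LINT y|lborel. complex_of_real (exp (- (1 / real (Suc n) * y)\<^sup>2 / 2)) * cis ((q - p) * y)))
     = 2 * pi * (LINT q|lborel. F q * complex_of_real (normal_density 0 (1 / real (Suc n)) (q - p)))" for n
    by (subst gaussian_fourier, simp, subst integral_mult_right_zero[symmetric])
       (simp add: mult_ac)
  show "(\<lambda>n. LINT q|lborel. F q *
            (LINT y|lborel. complex_of_real (exp (- (1 / real (Suc n) * y)\<^sup>2 / 2)) * cis ((q - p) * y)))
           \<longlonglongrightarrow> 2 * pi * F p"
    unfolding eq by (intro tendsto_intros gaussian_approximate_identity[OF assms])
  show "norm (LINT q|lborel. F q *
            (LINT y|lborel. complex_of_real (exp (- (1 / real (Suc n) * y)\<^sup>2 / 2)) * cis ((q - p) * y)))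
           \<le> 2 * pi * B" for n
    unfolding eq using gaussian_approximate_identity(2)[OF assms, of n p]
    by (simp add: norm_mult)
qed

lemma gaussian_damping_tendsto:
  "(\<lambda>n. exp (- (1 / real (Suc n) * y)\<^sup>2 / 2)) \<longlonglongrightarrow> 1"
proof -
  have "(\<lambda>n. inverse (real (Suc n))) \<longlonglongrightarrow> 0" by (rule LIMSEQ_inverse_real_of_nat)
  then have "(\<lambda>n. exp (- (inverse (real (Suc n)) * y)\<^sup>2 / 2)) \<longlonglongrightarrow> exp (- (0 * y)\<^sup>2 / 2)"
    by (intro tendsto_intros) auto
  then show ?thesis by (simp add: inverse_eq_divide)
qed

lemma integrable_mult_cis:
  fixes f :: "real \<Rightarrow> complex"
  assumes "integrable M f" and [measurable]: "g \<in> borel_measurable M"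
  shows "integrable M (\<lambda>x. f x * cis (g x))"
proof -
  note [measurable] = borel_measurable_integrable[OF assms(1)]
  show ?thesis
    by (rule Bochner_Integration.integrable_bound[OF assms(1)]) (auto simp: norm_mult)
qed

lemma fourier_integral_measurable[measurable]:
  fixes F :: "real \<Rightarrow> complex"
  assumes "integrable lborel F"
  shows "(\<lambda>y. LINT q|lborel. F q * cis (q * y)) \<in> borel_measurable borel"
proof -
  note [measurable] = borel_measurable_integrable[OF assms]
  show ?thesis by measurable
qed

lemma norm_fourier_integral_le:
  fixes F :: "real \<Rightarrow> complex"
  assumes "integrable lborel F"
  shows "norm (LINT q|lborel. F q * cis (q * y)) \<le> (LINT q|lborel. norm (F q))"
  by (rule order_trans[OF integral_norm_bound]) (simp add: norm_mult)

text \<open>The Gaussian factor makes the integrand integrable in y whether or not the Fourier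
  integral of \<open>F\<close> is, so the order of integration can be exchanged.\<close>

lemma damped_fourier_integral:
  fixes F :: "real \<Rightarrow> complex"
  assumes F: "integrable lborel F" and "\<sigma> > 0"
  shows "(LINT y|lborel. (LINT q|lborel. F q * cis (q * y)) * cis (- p * y) *
            complex_of_real (exp (- (\<sigma> * y)\<^sup>2 / 2))) =
         (LINT q|lborel. F q *
            (LINT y|lborel. complex_of_real (exp (- (\<sigma> * y)\<^sup>2 / 2)) * cis ((q - p) * y)))"
proof -
  let ?e = "\<lambda>y. complex_of_real (exp (- (\<sigma> * y)\<^sup>2 / 2))"
  have e: "integrable lborel (\<lambda>y. ?e y * cis (- p * y))"
    using assms(2) by (intro integrable_mult_cis integrable_gaussian) auto
  have "(LINT y|lborel. (?e y * cis (- p * y)) * (LINT q|lborel. F q * cis (q * y))) =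
    (LINT q|lborel. F q * (LINT y|lborel. (?e y * cis (- p * y)) * cis (q * y)))"
    by (rule integral_swap_kernel[OF e F, of _ 1]) auto
  moreover have "?e y * cis (- p * y) * cis (q * y) = ?e y * cis ((q - p) * y)" for q y
    by (simp add: mult.assoc cis_mult algebra_simps)
  moreover have "?e y * cis (- p * y) * (LINT q|lborel. F q * cis (q * y)) =
      (LINT q|lborel. F q * cis (q * y)) * cis (- p * y) * ?e y" for y
    by (simp only: mult_ac)
  ultimately show ?thesis by (simp only:)
qed

text \<open>The damped integrals converge to both sides: to the left one by dominated convergence
  with the transform itself as majorant, to the right one by Gaussian summation.\<close>

theorem fourier_inversion:
  fixes F :: "real \<Rightarrow> complex"
  assumes F: "integrable lborel F" and cont: "continuous_on UNIV F" and B: "\<And>x. norm (F x) \<le> B"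
    and Fh: "integrable lborel (\<lambda>y. LINT q|lborel. F q * cis (q * y))"
  shows "(LINT y|lborel. (LINT q|lborel. F q * cis (q * y)) * cis (- p * y)) = 2 * pi * F p"
proof (rule LIMSEQ_unique)
  let ?h = "\<lambda>y. LINT q|lborel. F q * cis (q * y)"
  let ?e = "\<lambda>n y. complex_of_real (exp (- (1 / real (Suc n) * y)\<^sup>2 / 2))"
  note [measurable] = borel_measurable_integrable[OF Fh] borel_measurable_integrable[OF F]
  show "(\<lambda>n. LINT y|lborel. ?h y * cis (- p * y) * ?e n y) \<longlonglongrightarrow> (LINT y|lborel. ?h y * cis (- p * y))"
  proof (rule integral_dominated_convergence[where w="\<lambda>y. norm (?h y)"])
    show "AE y in lborel. (\<lambda>n. ?h y * cis (- p * y) * ?e n y) \<longlonglongrightarrow> ?h y * cis (- p * y)"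
    proof (rule AE_I2)
      fix y
      have "(\<lambda>n. ?h y * cis (- p * y) * ?e n y) \<longlonglongrightarrow> ?h y * cis (- p * y) * complex_of_real 1"
        by (intro tendsto_intros gaussian_damping_tendsto)
      then show "(\<lambda>n. ?h y * cis (- p * y) * ?e n y) \<longlonglongrightarrow> ?h y * cis (- p * y)" by simp
    qed
    show "AE y in lborel. norm (?h y * cis (- p * y) * ?e n y) \<le> norm (?h y)" for n
      by (intro AE_I2) (auto simp: norm_mult intro!: mult_left_le)
  qed (use Fh in auto)
  show "(\<lambda>n. LINT y|lborel. ?h y * cis (- p * y) * ?e n y) \<longlonglongrightarrow> 2 * pi * F p"
    using gaussian_summation(1)[OF cont B] by (subst damped_fourier_integral[OF F]) auto
qed

text \<open>The Gaussian damping increases to 1, and the damped integrals of the squared modulus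
  converge to the right-hand side. Monotone convergence then gives square integrability and the
  value at once.\<close>

theorem plancherel:
  fixes F :: "real \<Rightarrow> complex"
  assumes F: "integrable lborel F" and cont: "continuous_on UNIV F" and B: "\<And>x. norm (F x) \<le> B"
  shows "integrable lborel (\<lambda>y. (norm (LINT q|lborel. F q * cis (q * y)))\<^sup>2)" (is ?int)
    and "(LINT y|lborel. (norm (LINT q|lborel. F q * cis (q * y)))\<^sup>2) =
           2 * pi * (LINT p|lborel. (norm (F p))\<^sup>2)" (is ?eq)
proof -
  let ?h = "\<lambda>y. LINT q|lborel. F q * cis (q * y)"
  let ?r = "\<lambda>n y. exp (- (1 / real (Suc n) * y)\<^sup>2 / 2)"
  let ?e = "\<lambda>n y. complex_of_real (?r n y)"
  let ?J = "\<lambda>n p. LINT q|lborel. F q * (LINT y|lborel. ?e n y * cis ((q - p) * y))"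
  note [measurable] = borel_measurable_integrable[OF F]
  have hm[measurable]: "?h \<in> borel_measurable borel" using F by (rule fourier_integral_measurable)
  have hb: "norm (?h y) \<le> (LINT q|lborel. norm (F q))" for y by (rule norm_fourier_integral_le[OF F])
  have eh: "integrable lborel (\<lambda>y. ?e n y * cnj (?h y))" for n
  proof (rule Bochner_Integration.integrable_bound)
    show "integrable lborel (\<lambda>y. ?e n y * complex_of_real (LINT q|lborel. norm (F q)))"
      by (intro integrable_mult_left integrable_gaussian) auto
    show "AE y in lborel. norm (?e n y * cnj (?h y)) \<le> norm (?e n y * complex_of_real (LINT q|lborel. norm (F q)))"
      using hb by (intro AE_I2) (auto simp: norm_mult intro!: mult_left_mono order_trans[OF _ abs_ge_self])
  qed measurable
  \<comment> \<open>One of the two factors of the squared modulus is expanded as a Fourier integral.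
    After the exchange the inner integral is, up to conjugation and the factor 2 pi, a Gaussian mean
    of \<open>F\<close> around p.\<close>
  have main: "(LINT y|lborel. (?e n y * cnj (?h y)) * ?h y) = (LINT p|lborel. F p * cnj (?J n p))" for n
  proof -
    have *: "(LINT y|lborel. (?e n y * cnj (?h y)) * cis (p * y)) = cnj (?J n p)" for p
    proof -
      have "(LINT y|lborel. (?e n y * cnj (?h y)) * cis (p * y)) =
            (LINT y|lborel. cnj (?h y * cis (- p * y) * ?e n y))"
        by (intro Bochner_Integration.integral_cong refl) (simp add: cis_cnj mult_ac)
      also have "\<dots> = cnj (LINT y|lborel. ?h y * cis (- p * y) * ?e n y)"
        by (rule Bochner_Integration.integral_cnj)
      also have "\<dots> = cnj (?J n p)"
        by (subst damped_fourier_integral[OF F]) simp_all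
      finally show ?thesis .
    qed
    have "(LINT y|lborel. (?e n y * cnj (?h y)) * ?h y) =
       (LINT p|lborel. F p * (LINT y|lborel. (?e n y * cnj (?h y)) * cis (p * y)))"
      by (rule integral_swap_kernel[OF eh F, of _ 1]) auto
    then show ?thesis unfolding * .
  qed
  have "(\<lambda>n. LINT p|lborel. F p * cnj (?J n p)) \<longlonglongrightarrow> (LINT p|lborel. F p * cnj (2 * pi * F p))"
  proof (rule integral_dominated_convergence[where w="\<lambda>p. norm (F p) * (2 * pi * B)"])
    show "AE p in lborel. (\<lambda>n. F p * cnj (?J n p)) \<longlonglongrightarrow> F p * cnj (2 * pi * F p)"
      by (intro AE_I2 tendsto_mult tendsto_const tendsto_cnj gaussian_summation(1)[OF cont B])
    show "AE p in lborel. norm (F p * cnj (?J n p)) \<le> norm (F p) * (2 * pi * B)" for n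
      using gaussian_summation(2)[OF cont B]
      by (intro AE_I2) (simp only: norm_mult complex_mod_cnj mult_left_mono norm_ge_zero)
    show "integrable lborel (\<lambda>p. norm (F p) * (2 * pi * B))" using F by simp
  qed measurable
  then have "(\<lambda>n. Re (LINT y|lborel. (?e n y * cnj (?h y)) * ?h y)) \<longlonglongrightarrow> Re (LINT p|lborel. F p * cnj (2 * pi * F p))"
    unfolding main by (rule tendsto_Re)
  moreover have "(LINT y|lborel. (?e n y * cnj (?h y)) * ?h y) = complex_of_real (LINT y|lborel. ?r n y * (norm (?h y))\<^sup>2)" for n
    unfolding integral_complex_of_real[symmetric]
    by (intro Bochner_Integration.integral_cong refl) (simp add: complex_norm_square[unfolded of_real_power] mult_ac)
  moreover have "(LINT p|lborel. F p * cnj (2 * pi * F p)) = complex_of_real (2 * pi * (LINT p|lborel. (norm (F p))\<^sup>2))"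
    unfolding integral_complex_of_real[symmetric] integral_mult_right_zero[symmetric] of_real_mult
    by (intro Bochner_Integration.integral_cong refl) (simp add: complex_norm_square[unfolded of_real_power] mult_ac)
  ultimately have lim: "(\<lambda>n. LINT y|lborel. ?r n y * (norm (?h y))\<^sup>2) \<longlonglongrightarrow> 2 * pi * (LINT p|lborel. (norm (F p))\<^sup>2)"
    by (simp only: Re_complex_of_real)
  have int: "integrable lborel (\<lambda>y. ?r n y * (norm (?h y))\<^sup>2)" for n
  proof -
    have "integrable lborel (\<lambda>y. ?e n y * cnj (?h y) * ?h y)"
      by (rule Bochner_Integration.integrable_bound[OF integrable_mult_left[OF eh, of n "complex_of_real (LINT q|lborel. norm (F q))"]])
         (use hb in \<open>auto simp: norm_mult intro!: mult_left_mono order_trans[OF _ abs_ge_self]\<close>)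
    from integrable_norm[OF this] show ?thesis
      by (simp add: norm_mult power2_eq_square mult_ac)
  qed
  \<comment> \<open>A larger n means a wider Gaussian, hence less damping at every point.\<close>
  have mono: "mono (\<lambda>n. ?r n y * (norm (?h y))\<^sup>2)" for y
  proof (intro monoI mult_right_mono)
    fix m n :: nat assume "m \<le> n"
    then have "\<bar>1 / real (Suc n) * y\<bar> \<le> \<bar>1 / real (Suc m) * y\<bar>"
      by (auto simp: abs_mult intro!: divide_left_mono)
    then have "(1 / real (Suc n) * y)\<^sup>2 \<le> (1 / real (Suc m) * y)\<^sup>2"
      by (simp only: abs_le_square_iff)
    then show "?r m y \<le> ?r n y" by simp
  qed simp
  have pt: "(\<lambda>n. ?r n y * (norm (?h y))\<^sup>2) \<longlonglongrightarrow> (norm (?h y))\<^sup>2" for y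
    using tendsto_mult[OF gaussian_damping_tendsto tendsto_const, of y "(norm (?h y))\<^sup>2"] by simp
  show ?int
    by (rule integrable_monotone_convergence[OF int _ _ lim]) (use mono pt hm in \<open>auto intro!: AE_I2\<close>)
  show ?eq
    by (rule integral_monotone_convergence[OF int _ _ lim]) (use mono pt hm in \<open>auto intro!: AE_I2\<close>)
qed

section \<open>Oscillatory integrals of continuous functions with compact support\<close>

lemma continuous_compact_support:
  fixes G :: "real \<Rightarrow> complex"
  assumes cont: "continuous_on UNIV G" and supp: "\<And>p. p \<notin> {a..b} \<Longrightarrow> G p = 0"
  obtains B where "B > 0" and "\<And>p. norm (G p) \<le> B * indicator {a..b} p" and "\<And>p. norm (G p) \<le> B"
    and "integrable lborel G"
proof -
  have [measurable]: "G \<in> borel_measurable borel" using cont by (rule borel_measurable_continuous_onI)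
  have "bounded (G ` {a..b})"
    by (intro compact_imp_bounded compact_continuous_image continuous_on_subset[OF cont]) auto
  then obtain B where B: "\<And>p. p \<in> {a..b} \<Longrightarrow> norm (G p) \<le> B" "B > 0"
    unfolding bounded_pos by blast
  have GB: "norm (G p) \<le> B * indicator {a..b} p" for p
    using B supp[of p] by (auto split: split_indicator)
  have "norm (G p) \<le> B" for p
    using GB[of p] B(2) by (auto split: split_indicator_asm)
  moreover have "integrable lborel G"
    by (rule Bochner_Integration.integrable_bound[where f="\<lambda>p. B * indicator {a..b} p"])
       (use B(2) in \<open>auto intro!: order_trans[OF GB] integrable_real_indicator simp: emeasure_lborel_Icc_eq\<close>)
  ultimately show ?thesis using that[OF B(2) GB] by blast
qed

text \<open>Shifting p by the half period pi / X reverses the sign of the oscillating factor. The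
  integral is therefore half the one with \<open>G p - G (p + pi / X)\<close> in place of
  \<open>G p\<close>, and this difference tends to 0 by continuity.\<close>

theorem riemann_lebesgue:
  fixes G :: "real \<Rightarrow> complex" and X :: "nat \<Rightarrow> real"
  assumes cont: "continuous_on UNIV G" and supp: "\<And>p. p \<notin> {a..b} \<Longrightarrow> G p = 0"
    and X: "filterlim (\<lambda>n. \<bar>X n\<bar>) at_top sequentially"
  shows "(\<lambda>n. LINT p|lborel. G p * cis (p * X n)) \<longlonglongrightarrow> 0"
proof -
  have [measurable]: "G \<in> borel_measurable borel" using cont by (rule borel_measurable_continuous_onI)
  obtain B where B: "B > 0" and GB: "\<And>p. norm (G p) \<le> B * indicator {a..b} p"
    and G: "integrable lborel G"
    using continuous_compact_support[OF cont supp] by blast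
  have X0: "eventually (\<lambda>n. \<bar>X n\<bar> \<ge> pi) sequentially"
    using X by (simp add: filterlim_at_top)
  have iX: "(\<lambda>n. pi / X n) \<longlonglongrightarrow> 0"
    using X by (intro tendsto_divide_0[OF tendsto_const])
      (simp add: filterlim_at_infinity_conv_norm_at_top)
  \<comment> \<open>The guard, which holds eventually, keeps the shift at most 1 in modulus for
    every n, including those with X n near 0. All the differences thus vanish outside
    \<open>{a-1..b+1}\<close>.\<close>
  define D where "D = (\<lambda>n p. G p - G (p + (if \<bar>X n\<bar> \<ge> pi then pi / X n else 0)))"
  have ev: "eventually (\<lambda>n. (LINT p|lborel. G p * cis (p * X n)) = (LINT p|lborel. D n p * cis (p * X n)) / 2) sequentially"
    using X0
  proof eventually_elim
    case (elim n)
    have n0: "X n \<noteq> 0"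
    proof
      assume "X n = 0"
      then show False using elim pi_gt_zero by linarith
    qed
    have "(LINT p|lborel. G p * cis (p * X n)) = (LINT p|lborel. G (p + pi / X n) * cis ((p + pi / X n) * X n))"
      by (subst lborel_integral_real_affine[of 1 _ "pi / X n"]) (auto simp: add.commute)
    also have "\<dots> = (LINT p|lborel. - (G (p + pi / X n) * cis (p * X n)))"
    proof (intro Bochner_Integration.integral_cong refl)
      fix p
      have "(p + pi / X n) * X n = p * X n + pi" using n0 by (simp add: field_simps)
      then have "cis ((p + pi / X n) * X n) = - cis (p * X n)"
        by (simp add: cis_mult[symmetric])
      then show "G (p + pi / X n) * cis ((p + pi / X n) * X n) = - (G (p + pi / X n) * cis (p * X n))"
        by simp
    qed
    also have "\<dots> = - (LINT p|lborel. G (p + pi / X n) * cis (p * X n))" by simp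
    finally have 1: "(LINT p|lborel. G (p + pi / X n) * cis (p * X n)) = - (LINT p|lborel. G p * cis (p * X n))"
      by simp
    have "(LINT p|lborel. D n p * cis (p * X n)) =
      (LINT p|lborel. G p * cis (p * X n) - G (p + pi / X n) * cis (p * X n))"
      using elim by (simp add: D_def algebra_simps)
    also have "\<dots> = (LINT p|lborel. G p * cis (p * X n)) - (LINT p|lborel. G (p + pi / X n) * cis (p * X n))"
      using lborel_integrable_real_affine[OF G, of 1 "pi / X n"]
      by (intro Bochner_Integration.integral_diff integrable_mult_cis G) (auto simp: add.commute)
    finally show ?case using 1 by simp
  qed
  have "(\<lambda>n. LINT p|lborel. D n p * cis (p * X n)) \<longlonglongrightarrow> (LINT (p::real)|lborel. 0)"
  proof (rule integral_dominated_convergence[where w="\<lambda>p. 2 * B * indicator {a-1..b+1} p"])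
    show "AE p in lborel. (\<lambda>n. D n p * cis (p * X n)) \<longlonglongrightarrow> 0"
    proof (rule AE_I2)
      fix p
      have "eventually (\<lambda>n. (if \<bar>X n\<bar> \<ge> pi then pi / X n else 0) = pi / X n) sequentially"
        using X0 by eventually_elim simp
      then have "(\<lambda>n. (if \<bar>X n\<bar> \<ge> pi then pi / X n else 0)) \<longlonglongrightarrow> 0"
        using iX by (simp add: tendsto_cong)
      then have "(\<lambda>n. p + (if \<bar>X n\<bar> \<ge> pi then pi / X n else 0)) \<longlonglongrightarrow> p + 0"
        by (intro tendsto_intros)
      moreover have "isCont G p" using cont by (simp add: continuous_on_eq_continuous_at)
      ultimately have "(\<lambda>n. D n p) \<longlonglongrightarrow> G p - G p"
        unfolding D_def by (intro tendsto_diff tendsto_const isCont_tendsto_compose[of p G]) auto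
      then show "(\<lambda>n. D n p * cis (p * X n)) \<longlonglongrightarrow> 0"
        by (subst tendsto_norm_zero_iff[symmetric]) (simp add: norm_mult tendsto_norm_zero_iff)
    qed
    fix n
    show "AE p in lborel. norm (D n p * cis (p * X n)) \<le> 2 * B * indicator {a-1..b+1} p"
    proof (rule AE_I2)
      fix p
      define d where "d = (if \<bar>X n\<bar> \<ge> pi then pi / X n else 0)"
      have d: "\<bar>d\<bar> \<le> 1"
      proof (cases "\<bar>X n\<bar> \<ge> pi")
        case True
        then have "0 < \<bar>X n\<bar>" using pi_gt_zero by linarith
        then show ?thesis using True by (simp add: d_def)
      qed (simp add: d_def)
      have "norm (D n p * cis (p * X n)) \<le> norm (G p) + norm (G (p + d))"
        by (simp add: norm_mult D_def d_def[symmetric] norm_triangle_ineq4)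
      also have "\<dots> \<le> B * indicator {a..b} p + B * indicator {a..b} (p + d)"
        by (intro add_mono GB)
      also have "\<dots> \<le> 2 * B * indicator {a-1..b+1} p"
        using d B by (auto split: split_indicator)
      finally show "norm (D n p * cis (p * X n)) \<le> 2 * B * indicator {a-1..b+1} p" .
    qed
  qed (auto simp: D_def emeasure_lborel_Icc_eq intro!: integrable_mult_right integrable_real_indicator)
  then have "(\<lambda>n. (LINT p|lborel. D n p * cis (p * X n)) / 2) \<longlonglongrightarrow> 0 / 2"
    by (intro tendsto_divide tendsto_const) auto
  then show ?thesis
    by (subst tendsto_cong[OF ev]) simp
qed

subsection \<open>Gamma function on the imaginary axis\<close>

text \<open>Euler's integral with \<open>exp t\<close> as variable: the half-line becomes the whole
  line and dilations become translations.\<close>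

lemma Gamma_integral_exp:
  assumes "Re z > 0"
  shows "integrable lborel (\<lambda>t. exp (z * of_real t - of_real (exp t)))"
    and "(LINT t|lborel. exp (z * of_real t - of_real (exp t))) = Gamma z"
proof -
  let ?f = "\<lambda>t. complex_of_real t powr (z - 1) / of_real (exp t)"
  have im: "exp ` (UNIV :: real set) = {0<..}"
  proof -
    have "x \<in> range exp" if "x > 0" for x :: real
      using that by (metis exp_ln rangeI)
    then show ?thesis by auto
  qed
  have "integral {0<..} ?f = Gamma z"
    using Gamma_integral_complex'[OF assms] by (rule integral_unique)
  with absolutely_integrable_Gamma_integral'[OF assms]
  have "?f absolutely_integrable_on (exp ` UNIV) \<and> integral (exp ` UNIV) ?f = Gamma z"
    unfolding im by blast
  then have *: "(\<lambda>t. \<bar>exp t\<bar> *\<^sub>R ?f (exp t)) absolutely_integrable_on UNIV \<and>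
      integral UNIV (\<lambda>t. \<bar>exp t\<bar> *\<^sub>R ?f (exp t)) = Gamma z"
    by (subst has_absolute_integral_change_of_variables_real)
       (auto intro!: derivative_eq_intros inj_onI)
  have eq: "\<bar>exp t\<bar> *\<^sub>R ?f (exp t) = exp (z * of_real t - of_real (exp t))" for t
    by (simp add: powr_def scaleR_conv_of_real exp_of_real[symmetric] Ln_of_real exp_diff)
       (simp add: exp_add[symmetric] algebra_simps)
  have "integrable lebesgue (\<lambda>t. exp (z * of_real t - of_real (exp t)))"
    using * unfolding eq set_integrable_def by simp
  then show int: "integrable lborel (\<lambda>t. exp (z * of_real t - of_real (exp t)))"
    by (subst (asm) integrable_completion) (auto intro!: borel_measurable_continuous_onI continuous_intros)
  show "(LINT t|lborel. exp (z * of_real t - of_real (exp t))) = Gamma z"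
    using * unfolding eq by (simp add: integral_lborel[OF int])
qed

text \<open>With t = 1 / (1 + exp (- y)) the integrand is t^a (1 - t)^b and dy = dt / (t (1 - t)),
  so this is the Beta integral. The proof evaluates the double integral of
  \<open>\<phi> t * \<psi> (t - y)\<close> in both orders: y first gives the product of two Gamma
  values, t first gives \<open>Gamma (a + b) * f y\<close>.\<close>

lemma Beta_integral_logistic:
  assumes a: "Re a > 0" and b: "Re b > 0"
  defines "f \<equiv> \<lambda>y. exp (- b * of_real y - (a + b) * of_real (ln (1 + exp (- y))))"
  shows "integrable lborel f" and "(LINT y|lborel. f y) = Gamma a * Gamma b / Gamma (a + b)"
proof -
  define \<phi> where "\<phi> = (\<lambda>t. exp (a * complex_of_real t - of_real (exp t)))"
  define \<psi> where "\<psi> = (\<lambda>t. exp (b * complex_of_real t - of_real (exp t)))"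
  have [measurable]: "\<phi> \<in> borel_measurable borel" "\<psi> \<in> borel_measurable borel"
    unfolding \<phi>_def \<psi>_def by (auto intro!: borel_measurable_continuous_onI continuous_intros)
  have \<phi>: "integrable lborel \<phi>" "(LINT t|lborel. \<phi> t) = Gamma a"
    unfolding \<phi>_def using Gamma_integral_exp[OF a] by auto
  have \<psi>: "integrable lborel \<psi>" "(LINT t|lborel. \<psi> t) = Gamma b"
    unfolding \<psi>_def using Gamma_integral_exp[OF b] by auto
  have \<psi>_refl: "integrable lborel (\<lambda>y. \<psi> (t - y))" for t
    using lborel_integrable_real_affine[OF \<psi>(1), of "-1" t] by simp
  have pair: "integrable (lborel \<Otimes>\<^sub>M lborel) (\<lambda>(t, y). \<phi> t * \<psi> (t - y))"
  proof (rule lborel_pair.Fubini_integrable)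
    have "(LINT y|lborel. norm (\<psi> (t - y))) = (LINT y|lborel. norm (\<psi> y))" for t
      by (subst lborel_integral_real_affine[of "-1" _ t]) auto
    then show "integrable lborel (\<lambda>t. LINT y|lborel. norm (case (t, y) of (t, y) \<Rightarrow> \<phi> t * \<psi> (t - y)))"
      using \<phi>(1) by (simp add: norm_mult)
    show "AE t in lborel. integrable lborel (\<lambda>y. case (t, y) of (t, y) \<Rightarrow> \<phi> t * \<psi> (t - y))"
      using \<psi>_refl by simp
  qed simp
  have inner: "(LINT t|lborel. \<phi> t * \<psi> (t - y)) = Gamma (a + b) * f y" for y
  proof -
    \<comment> \<open>Translating t by c turns \<open>exp t + exp (t - y)\<close> into
      \<open>exp t\<close>, which leaves an Euler integral with parameter a + b.\<close>
    define c where "c = ln (1 + exp (- y))"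
    have "1 + exp (- y) > 0" by (simp add: add_pos_pos)
    then have c: "exp (- c) * (1 + exp (- y)) = 1"
      by (simp add: c_def exp_minus[of "ln _"])
    have "(LINT t|lborel. \<phi> t * \<psi> (t - y)) = (LINT t|lborel. \<phi> (t - c) * \<psi> (t - c - y))"
      by (subst lborel_integral_real_affine[of 1 _ "- c"]) auto
    also have "\<dots> = (LINT t|lborel. f y * exp ((a + b) * complex_of_real t - of_real (exp t)))"
    proof (intro Bochner_Integration.integral_cong refl)
      fix t
      have "exp (t - c) + exp (t - c - y) = exp t * (exp (- c) * (1 + exp (- y)))"
        by (simp add: distrib_left exp_add[symmetric])
      then have "exp t = exp (t - c) + exp (t - c - y)" unfolding c by simp
      then show "\<phi> (t - c) * \<psi> (t - c - y) = f y * exp ((a + b) * complex_of_real t - of_real (exp t))"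
        unfolding \<phi>_def \<psi>_def f_def c_def[symmetric] exp_add[symmetric]
        by (simp add: algebra_simps)
    qed
    also have "\<dots> = f y * Gamma (a + b)"
      using Gamma_integral_exp[of "a + b"] a b by simp
    finally show ?thesis by simp
  qed
  \<comment> \<open>\<open>Gamma\<close> has the value 0 exactly at its poles, the nonpositive
    integers, and the real part of a + b is positive.\<close>
  have G: "Gamma (a + b) \<noteq> 0" using a b by (auto simp: Gamma_eq_zero_iff elim!: nonpos_Ints_cases' dest!: arg_cong[of "a + b" _ Re])
  have "integrable lborel (\<lambda>y. LINT t|lborel. (\<lambda>(t, y). \<phi> t * \<psi> (t - y)) (t, y))"
    using lborel_pair.integrable_snd[OF pair] by simp
  then have "integrable lborel (\<lambda>y. Gamma (a + b) * f y)" by (simp add: inner)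
  then have "integrable lborel (\<lambda>y. inverse (Gamma (a + b)) * (Gamma (a + b) * f y))"
    by (rule integrable_mult_right)
  moreover have "inverse (Gamma (a + b)) * (Gamma (a + b) * x) = x" for x
    unfolding mult.assoc[symmetric] left_inverse[OF G] by (rule mult_1_left)
  ultimately show "integrable lborel f" by (simp only:)
  have "Gamma (a + b) * (LINT y|lborel. f y) = (LINT y|lborel. LINT t|lborel. \<phi> t * \<psi> (t - y))"
    by (simp add: inner)
  also have "\<dots> = (LINT t|lborel. LINT y|lborel. \<phi> t * \<psi> (t - y))"
    using lborel_pair.Fubini_integral[OF pair] by simp
  also have "\<dots> = (LINT t|lborel. \<phi> t * Gamma b)"
  proof (intro Bochner_Integration.integral_cong refl)
    fix t
    have "(LINT y|lborel. \<psi> (t - y)) = (LINT y|lborel. \<psi> y)"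
      by (subst lborel_integral_real_affine[of "-1" _ t]) auto
    then show "(LINT y|lborel. \<phi> t * \<psi> (t - y)) = \<phi> t * Gamma b" using \<psi>(2) by simp
  qed
  also have "\<dots> = Gamma a * Gamma b" using \<phi> by simp
  finally show "(LINT y|lborel. f y) = Gamma a * Gamma b / Gamma (a + b)"
    using G by (simp add: field_simps)
qed

text \<open>On the imaginary axis the conjugate of Gamma(z) is Gamma(- z), so the squared modulus is
  the left-hand side of the reflection formula, and the sine of an imaginary argument becomes
  \<open>sinh\<close>.\<close>

lemma norm_Gamma_imaginary:
  assumes "y > 0"
  shows "(norm (Gamma (\<i> * of_real y)))\<^sup>2 = pi / (y * sinh (pi * y))"
proof -
  have "complex_of_real ((norm (Gamma (\<i> * of_real y)))\<^sup>2) = Gamma (\<i> * of_real y) * cnj (Gamma (\<i> * of_real y))"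
    by (rule complex_norm_square)
  also have "cnj (Gamma (\<i> * of_real y)) = Gamma (- (\<i> * of_real y))"
    by (simp add: cnj_Gamma)
  also have "Gamma (\<i> * of_real y) * Gamma (- (\<i> * of_real y)) =
     - of_real pi / ((\<i> * of_real y) * sin (of_real pi * (\<i> * of_real y)))"
    by (rule Gamma_reflection_complex')
  also have "sin (of_real pi * (\<i> * of_real y)) = \<i> * complex_of_real (sinh (pi * y))"
  proof -
    have "sin (of_real pi * (\<i> * of_real y)) = sin (\<i> * of_real (pi * y))"
      by (simp add: mult_ac)
    also have "\<dots> = \<i> * ((exp (of_real (pi * y)) - exp (- of_real (pi * y))) / 2)"
      by (simp add: sin_i_times exp_minus)
    also have "(exp (of_real (pi * y)) - exp (- of_real (pi * y))) / 2 = complex_of_real (sinh (pi * y))"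
      by (simp add: sinh_field_def exp_of_real[symmetric])
    finally show ?thesis .
  qed
  also have "- of_real pi / ((\<i> * of_real y) * (\<i> * complex_of_real (sinh (pi * y)))) =
      complex_of_real (pi / (y * sinh (pi * y)))"
    by (simp add: mult_ac)
  finally show ?thesis by (simp only: of_real_eq_iff)
qed

section \<open>Ratios of Gamma values along the imaginary axis\<close>

lemma Digamma_imaginary_increment:
  assumes p: "p > 0" and k: "k \<ge> (1::real)"
  shows "norm (Digamma (\<i> * of_real (k + p)) - Digamma (\<i> * of_real k) - of_real (p / k))
      \<le> 4 * p * (1 + p) / k\<^sup>2"
proof -
  define z where "z = \<i> * complex_of_real k"
  define w where "w = \<i> * complex_of_real p"
  have zw: "\<i> * of_real (k + p) = z + w" by (simp add: z_def w_def algebra_simps)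
  have nz: "z + of_nat n \<noteq> 0" "z + w + of_nat n \<noteq> 0" for n
    using p k by (auto simp: z_def w_def complex_eq_iff)
  have sums_Digamma: "(\<lambda>n. inverse (of_nat (Suc n)) - inverse (u + of_nat n)) sums
      (Digamma u + euler_mascheroni)" if "u \<noteq> 0" for u :: complex
    using summable_sums[OF summable_Digamma[OF that]] by (simp add: Digamma_def)
  \<comment> \<open>Subtracting the two Digamma series leaves terms inverse (z + n) - inverse (z + w
    + n).\<close>
  have "(\<lambda>n. (inverse (of_nat (Suc n)) - inverse (z + w + of_nat n)) -
       (inverse (of_nat (Suc n)) - inverse (z + of_nat n))) sums
      ((Digamma (z + w) + euler_mascheroni) - (Digamma z + euler_mascheroni))"
    using nz[of 0] by (intro sums_diff sums_Digamma) auto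
  \<comment> \<open>The leading term p / k equals w / z, which is w times a telescoping series.
    Subtracting this series leaves terms that decay like the inverse cube of n.\<close>
  moreover have "(\<lambda>n. inverse (z + of_nat n) - inverse (z + of_nat (Suc n)))
                  sums (inverse (z + of_nat 0) - 0)"
    by (intro telescope_sums'[OF filterlim_compose[OF tendsto_inverse_0]]
              tendsto_add_filterlim_at_infinity[OF tendsto_const] tendsto_of_nat)
  then have "(\<lambda>n. w * (inverse (z + of_nat n) - inverse (z + of_nat (Suc n)))) sums
       (w * (inverse (z + of_nat 0) - 0))"
    by (rule sums_mult)
  ultimately have "(\<lambda>n. ((inverse (of_nat (Suc n)) - inverse (z + w + of_nat n)) -
       (inverse (of_nat (Suc n)) - inverse (z + of_nat n))) -
       w * (inverse (z + of_nat n) - inverse (z + of_nat (Suc n)))) sums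
      (((Digamma (z + w) + euler_mascheroni) - (Digamma z + euler_mascheroni)) -
       w * (inverse (z + of_nat 0) - 0))" (is "?d sums ?D")
    by (rule sums_diff)
  \<comment> \<open>A majorant that telescopes: its sum is explicit and supplies the second factor 1
    / k.\<close>
  moreover have "(\<lambda>n. 4 * p * (1 + p) / k * (1 / (k + real n) - 1 / (k + real (Suc n)))) sums
      (4 * p * (1 + p) / k * (1 / (k + real 0) - 0))"
  proof (intro sums_mult telescope_sums')
    show "(\<lambda>n. 1 / (k + real n)) \<longlonglongrightarrow> 0"
      by (intro tendsto_divide_0[OF tendsto_const] filterlim_at_top_imp_at_infinity
          filterlim_tendsto_add_at_top[OF tendsto_const] filterlim_real_sequentially)
  qed
  moreover have "norm (?d n) \<le> 4 * p * (1 + p) / k * (1 / (k + real n) - 1 / (k + real (Suc n)))" for n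
  proof -
    define u where "u = z + of_nat n"
    have u: "u \<noteq> 0" "u + w \<noteq> 0" "u + 1 \<noteq> 0" and un: "u + w = z + w + of_nat n" "u + 1 = z + of_nat (Suc n)"
      using nz[of n] nz[of "Suc n"] by (auto simp: u_def algebra_simps)
    have "?d n = inverse u - inverse (u + w) - w * (inverse u - inverse (u + 1))"
      unfolding un unfolding u_def by simp
    also have "\<dots> = w * (1 - w) / (u * (u + w) * (u + 1))"
    proof -
      define v t where "v = u + w" and "t = u + 1"
      have nz: "v \<noteq> 0" "t \<noteq> 0" "u \<noteq> 0" using u by (auto simp: v_def t_def)
      have i: "inverse u - inverse v = (v - u) / (u * v)" "inverse u - inverse t = (t - u) / (u * t)"
        using nz by (simp_all add: diff_divide_distrib inverse_eq_divide)
      have vt: "v - u = w" "t - u = 1" by (simp_all add: v_def t_def)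
      note e1 = i(1)[unfolded vt] and e2 = i(2)[unfolded vt]
      have e3: "w / (u * v) = w * t / (u * v * t)" "w * (1 / (u * t)) = w * v / (u * v * t)"
        using nz by simp_all
      have e4: "w * t - w * v = w * (1 - w)" by (simp add: v_def t_def algebra_simps)
      have "inverse u - inverse v - w * (inverse u - inverse t) = (w * t - w * v) / (u * v * t)"
        unfolding e1 e2 e3 by (rule diff_divide_distrib[symmetric])
      then show ?thesis unfolding e4 unfolding v_def t_def .
    qed
    finally have d: "norm (?d n) = norm w * norm (1 - w) / (norm u * norm (u + w) * norm (u + 1))"
      by (simp only: norm_mult norm_divide)
    have nu: "(norm u)\<^sup>2 = (real n)\<^sup>2 + k\<^sup>2"
      by (simp add: u_def z_def cmod_power2)
    have "(norm u)\<^sup>2 \<le> (norm (u + w))\<^sup>2"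
      unfolding cmod_power2 using k p by (auto simp: u_def z_def w_def intro!: power_mono)
    then have u1: "norm u \<le> norm (u + w)" by (rule power2_le_imp_le) simp
    have "(norm u)\<^sup>2 \<le> (norm (u + 1))\<^sup>2"
      unfolding cmod_power2 using k p by (auto simp: u_def z_def w_def intro!: power_mono)
    then have u2: "norm u \<le> norm (u + 1)" by (rule power2_le_imp_le) simp
    have "k\<^sup>2 \<le> (norm u)\<^sup>2" unfolding nu by simp
    then have u3: "k \<le> norm u" by (rule power2_le_imp_le) simp
    \<comment> \<open>The 4 is a product of two factors 2: k + n + 1 \<le> 2 (k + n), where k \<ge>
      1 enters, and (k + n)^2 \<le> 2 (k^2 + n^2).\<close>
    have "(k + real n) * (k + real (Suc n)) \<le> 4 * (norm u)\<^sup>2"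
    proof -
      have "(k + real n) * (k + real (Suc n)) \<le> (k + real n) * (2 * (k + real n))"
        using k by (intro mult_left_mono) auto
      also have "\<dots> \<le> 4 * (norm u)\<^sup>2"
        unfolding nu using sum_squares_bound[of k "real n"] by (simp add: power2_eq_square algebra_simps)
      finally show ?thesis .
    qed
    from u3 this have "k * ((k + real n) * (k + real (Suc n))) \<le> norm u * (4 * (norm u)\<^sup>2)"
      by (rule mult_mono) (use k in auto)
    also have "\<dots> = 4 * (norm u * norm u * norm u)" by (simp add: power2_eq_square)
    also have "\<dots> \<le> 4 * (norm u * norm (u + w) * norm (u + 1))"
      using u1 u2 by (intro mult_left_mono mult_mono) auto
    finally have den: "k * ((k + real n) * (k + real (Suc n))) / 4 \<le> norm u * norm (u + w) * norm (u + 1)"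
      by simp
    have "norm (1 - w) \<le> 1 + p" using norm_triangle_ineq4[of 1 w] p by (simp add: w_def norm_mult)
    then have "norm w * norm (1 - w) \<le> p * (1 + p)"
      using p by (simp add: w_def norm_mult mult_left_mono)
    then have "norm (?d n) \<le> p * (1 + p) / (k * ((k + real n) * (k + real (Suc n))) / 4)"
      unfolding d using den k p by (intro frac_le) auto
    also have "\<dots> = 4 * p * (1 + p) / k * (1 / (k + real n) - 1 / (k + real (Suc n)))"
      using k by (simp add: field_simps)
    finally show ?thesis .
  qed
  ultimately have "norm ?D \<le> 4 * p * (1 + p) / k * (1 / (k + real 0) - 0)"
    by (rule norm_sums_le)
  moreover have "?D = Digamma (z + w) - Digamma z - of_real (p / k)"
    using k by (simp add: z_def w_def field_simps)
  ultimately show ?thesis unfolding zw z_def[symmetric] by (simp add: power2_eq_square)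
qed


text \<open>By Stirling's formula the quotient of Gamma values oscillates like exp (i p ln k) for
  large k. The last factor removes this oscillation, so that a limit exists.\<close>

definition gamma_phase :: "real \<Rightarrow> real \<Rightarrow> complex" where
  "gamma_phase p k = Gamma (\<i> * of_real (k + p)) / Gamma (\<i> * of_real k) * cis (- p * ln k)"

lemma imaginary_not_nonpos_Int:
  "y \<noteq> 0 \<Longrightarrow> \<i> * complex_of_real y \<notin> \<int>\<^sub>\<le>\<^sub>0"
  by (auto elim!: nonpos_Ints_cases' simp: complex_eq_iff)

lemma norm_gamma_phase:
  assumes "p > 0" "k > 0"
  shows "(norm (gamma_phase p k))\<^sup>2 = k * sinh (pi * k) / ((k + p) * sinh (pi * (k + p)))"
  using assms
  by (simp add: gamma_phase_def norm_mult norm_divide power_divide norm_Gamma_imaginary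
      del: of_real_add)

text \<open>As \<open>sinh\<close> increases, the quotient of its values in
  \<open>norm_gamma_phase\<close> is at most 1. The first bound serves small k, the second the
  derivative in k.\<close>

lemma norm_gamma_phase_le:
  assumes "p > 0" "k > 0"
  shows "(norm (gamma_phase p k))\<^sup>2 \<le> k / (k + p)" and "norm (gamma_phase p k) \<le> 1"
proof -
  have s: "0 < sinh (pi * k)" "sinh (pi * k) \<le> sinh (pi * (k + p))"
    using assms by auto
  then have "(norm (gamma_phase p k))\<^sup>2 \<le> k * sinh (pi * (k + p)) / ((k + p) * sinh (pi * (k + p)))"
    unfolding norm_gamma_phase[OF assms] using assms
    by (intro divide_right_mono mult_left_mono) auto
  also have "\<dots> = k / (k + p)" using s by simp
  finally show *: "(norm (gamma_phase p k))\<^sup>2 \<le> k / (k + p)" .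
  also have "\<dots> \<le> 1\<^sup>2" using assms by simp
  finally show "norm (gamma_phase p k) \<le> 1" by (rule power2_le_imp_le) simp
qed

text \<open>This is a logarithmic derivative. The factor \<open>cis (- p * ln k)\<close> contributes
  the term p / k, which cancels the leading part of the Digamma increment and leaves a derivative of
  order 1 / k^2.\<close>

lemma gamma_phase_has_vector_derivative:
  assumes "p > 0" "k > 0"
  shows "(gamma_phase p has_vector_derivative
      gamma_phase p k * (\<i> * (Digamma (\<i> * of_real (k + p)) - Digamma (\<i> * of_real k) - of_real (p / k)))) (at k)"
proof -
  \<comment> \<open>An extension of \<open>gamma_phase p\<close> to complex k by means of the
    principal logarithm, so that the complex product and quotient rules apply; the two agree on the
    positive reals.\<close>
  let ?G = "\<lambda>z. Gamma (\<i> * (z + of_real p)) / Gamma (\<i> * z) * exp (\<i> * (- of_real p * Ln z))"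
  let ?D = "\<lambda>z. ?G z * (\<i> * (Digamma (\<i> * (z + of_real p)) - Digamma (\<i> * z) - of_real p / z))"
  have n1: "\<i> * (complex_of_real k + complex_of_real p) \<notin> \<int>\<^sub>\<le>\<^sub>0" "\<i> * complex_of_real k \<notin> \<int>\<^sub>\<le>\<^sub>0"
    using imaginary_not_nonpos_Int[of "k + p"] imaginary_not_nonpos_Int[of k] assms by auto
  then have n2: "Gamma (\<i> * complex_of_real k) \<noteq> 0" by (simp add: Gamma_eq_zero_iff)
  have n3: "complex_of_real k \<notin> \<real>\<^sub>\<le>\<^sub>0" "k \<noteq> 0" using assms by auto
  have alg: "(A * a * \<i> * B - A * (B * b * \<i>)) / (B * B) * E + E * (\<i> * (- of_real p * c)) * (A / B) =
      A / B * E * (\<i> * (a - b - of_real p * c))" if "B \<noteq> 0" for A B E a b c :: complex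
    using that by (simp add: diff_divide_distrib) (simp add: algebra_simps diff_divide_distrib add_divide_distrib)
  have "((\<lambda>z. Gamma (\<i> * (z + of_real p))) has_field_derivative
      Gamma (\<i> * (of_real k + of_real p)) * Digamma (\<i> * (of_real k + of_real p)) * \<i>) (at (of_real k))"
    using n1 by (auto intro!: derivative_eq_intros)
  moreover have "((\<lambda>z. Gamma (\<i> * z)) has_field_derivative
      Gamma (\<i> * of_real k) * Digamma (\<i> * of_real k) * \<i>) (at (of_real k))"
    using n1 by (auto intro!: derivative_eq_intros)
  ultimately have "((\<lambda>z. Gamma (\<i> * (z + of_real p)) / Gamma (\<i> * z)) has_field_derivative
      (Gamma (\<i> * (of_real k + of_real p)) * Digamma (\<i> * (of_real k + of_real p)) * \<i> * Gamma (\<i> * of_real k)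
        - Gamma (\<i> * (of_real k + of_real p)) * (Gamma (\<i> * of_real k) * Digamma (\<i> * of_real k) * \<i>))
      / (Gamma (\<i> * of_real k) * Gamma (\<i> * of_real k))) (at (of_real k))"
    by (rule DERIV_divide) (rule n2)
  moreover have "((\<lambda>z. exp (\<i> * (- of_real p * Ln z))) has_field_derivative
      exp (\<i> * (- of_real p * Ln (of_real k))) * (\<i> * (- of_real p * (1 / of_real k)))) (at (of_real k))"
    using n3 by (auto intro!: derivative_eq_intros simp: divide_inverse)
  ultimately have "(?G has_field_derivative ?D (of_real k)) (at (of_real k))"
    by (rule DERIV_cong[OF DERIV_mult]) (simp only: alg[OF n2], simp)
  then have D: "((\<lambda>x. ?G (of_real x)) has_vector_derivative ?D (of_real k)) (at k)"
    by (rule has_vector_derivative_real_field)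
  have G: "?G (of_real x) = gamma_phase p x" if "x > 0" for x
    using that by (simp add: gamma_phase_def cis_conv_exp Ln_of_real)
  have "(gamma_phase p has_vector_derivative ?D (of_real k)) (at k)"
    by (rule has_vector_derivative_transform_within_open[OF D, of "{0<..}"]) (use assms G in auto)
  then show ?thesis unfolding G[OF assms(2)] by simp
qed

text \<open>The derivative is at most 4 p (1 + p) / x^2 because \<open>gamma_phase\<close> has
  modulus at most 1. The right-hand side is the integral of this bound from k to l.\<close>

lemma gamma_phase_increment:
  assumes "p > 0" "1 \<le> k" "k \<le> l"
  shows "norm (gamma_phase p l - gamma_phase p k) \<le> 4 * p * (1 + p) / k - 4 * p * (1 + p) / l"
proof (cases "k = l")
  case False
  with assms have "k < l" by simp
  have "norm (gamma_phase p l - gamma_phase p k) \<le> (- (4 * p * (1 + p)) / l) - (- (4 * p * (1 + p)) / k)"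
  proof (rule differentiable_bound_general[OF \<open>k < l\<close>])
    let ?D = "\<lambda>x. gamma_phase p x * (\<i> * (Digamma (\<i> * of_real (x + p)) - Digamma (\<i> * of_real x) - of_real (p / x)))"
    show "continuous_on {k..l} (gamma_phase p)"
      using assms by (intro continuous_at_imp_continuous_on ballI
         has_vector_derivative_continuous[OF gamma_phase_has_vector_derivative]) auto
    show "continuous_on {k..l} (\<lambda>x. - (4 * p * (1 + p)) / x)"
      using assms by (intro continuous_intros) auto
    fix x assume x: "k < x" "x < l"
    then show "(gamma_phase p has_vector_derivative ?D x) (at x)"
      using assms by (intro gamma_phase_has_vector_derivative) auto
    show "((\<lambda>x. - (4 * p * (1 + p)) / x) has_vector_derivative 4 * p * (1 + p) / x\<^sup>2) (at x)"
      using assms x unfolding has_real_derivative_iff_has_vector_derivative[symmetric]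
      by (auto intro!: derivative_eq_intros simp: power2_eq_square)
    have "norm (?D x) \<le> 1 * norm (Digamma (\<i> * of_real (x + p)) - Digamma (\<i> * of_real x) - of_real (p / x))"
      unfolding norm_mult norm_ii mult_1_left
      by (rule mult_left_le_one_le) (use norm_gamma_phase_le(2)[of p x] assms x in auto)
    also have "\<dots> \<le> 4 * p * (1 + p) / x\<^sup>2"
      using Digamma_imaginary_increment[of p x] assms x by simp
    finally show "norm (?D x) \<le> 4 * p * (1 + p) / x\<^sup>2" .
  qed
  then show ?thesis by simp
qed simp

text \<open>The limit runs along the integers from 1 on, where the increment bound is available;
  \<open>gamma_phase_limit_error\<close> passes to real k with a rate.\<close>

definition gamma_phase_limit :: "real \<Rightarrow> complex" where
  "gamma_phase_limit p = lim (\<lambda>n. gamma_phase p (real (Suc n)))"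

lemma gamma_phase_tendsto:
  assumes "p > 0"
  shows "(\<lambda>n. gamma_phase p (real (Suc n))) \<longlonglongrightarrow> gamma_phase_limit p"
proof -
  define C where "C = 4 * p * (1 + p)"
  have C: "C > 0" using assms by (simp add: C_def)
  have inc: "norm (gamma_phase p (real (Suc n)) - gamma_phase p (real (Suc m))) \<le> C / real (Suc m)"
    if "m \<le> n" for m n
  proof -
    have "norm (gamma_phase p (real (Suc n)) - gamma_phase p (real (Suc m))) \<le> C / real (Suc m) - C / real (Suc n)"
      unfolding C_def by (rule gamma_phase_increment) (use assms that in auto)
    moreover have "0 \<le> C / real (Suc n)" using C by simp
    ultimately show ?thesis by linarith
  qed
  have "Cauchy (\<lambda>n. gamma_phase p (real (Suc n)))"
  proof (rule metric_CauchyI)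
    fix e :: real assume e: "e > 0"
    \<comment> \<open>Every later term lies within e / 2 of the term with index M, which serves as
      common point of comparison.\<close>
    obtain M where M: "real M > 2 * C / e" using reals_Archimedean2 by blast
    have 2: "C / real (Suc M) < e / 2"
    proof -
      have "2 * C / e < real (Suc M)" using M by simp
      then show ?thesis using e by (simp add: field_simps)
    qed
    show "\<exists>M. \<forall>m\<ge>M. \<forall>n\<ge>M. dist (gamma_phase p (real (Suc m))) (gamma_phase p (real (Suc n))) < e"
    proof (intro exI[of _ M] allI impI)
      fix m n assume "M \<le> m" "M \<le> n"
      then have "norm (gamma_phase p (real (Suc m)) - gamma_phase p (real (Suc M))) < e / 2"
         "norm (gamma_phase p (real (Suc n)) - gamma_phase p (real (Suc M))) < e / 2"
        using inc[of M m] inc[of M n] 2 by linarith+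
      then show "dist (gamma_phase p (real (Suc m))) (gamma_phase p (real (Suc n))) < e"
        unfolding dist_norm[symmetric] by (rule dist_triangle_half_l)
    qed
  qed
  then show ?thesis
    unfolding gamma_phase_limit_def by (simp add: Cauchy_convergent_iff convergent_LIMSEQ_iff)
qed

lemma gamma_phase_limit_error:
  assumes "p > 0" "1 \<le> k"
  shows "norm (gamma_phase p k - gamma_phase_limit p) \<le> 4 * p * (1 + p) / k"
proof (rule Lim_norm_ubound)
  show "((\<lambda>n. gamma_phase p k - gamma_phase p (real (Suc n))) \<longlongrightarrow> gamma_phase p k - gamma_phase_limit p) sequentially"
    by (intro tendsto_intros gamma_phase_tendsto assms)
  have "eventually (\<lambda>n. k \<le> real (Suc n)) sequentially"
    using eventually_ge_at_top[of "nat \<lceil>k\<rceil>"] by eventually_elim linarith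
  then show "eventually (\<lambda>n. norm (gamma_phase p k - gamma_phase p (real (Suc n))) \<le> 4 * p * (1 + p) / k) sequentially"
  proof eventually_elim
    case (elim n)
    have "0 \<le> 4 * p * (1 + p) / real (Suc n)" using assms by simp
    then show ?case
      using gamma_phase_increment[OF assms elim] by (simp add: norm_minus_commute)
  qed
qed simp

text \<open>The modulus is explicit before the limit, and the quotient of \<open>sinh\<close> values
  tends to the exponential. This is one of the two sources of the thermal factor; the other is the
  modulus of Gamma(- i p).\<close>

lemma norm_gamma_phase_limit:
  assumes "p > 0"
  shows "(norm (gamma_phase_limit p))\<^sup>2 = exp (- pi * p)"
proof (rule LIMSEQ_unique)
  show "(\<lambda>n. (norm (gamma_phase p (real (Suc n))))\<^sup>2) \<longlonglongrightarrow> (norm (gamma_phase_limit p))\<^sup>2"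
    by (intro tendsto_intros gamma_phase_tendsto assms)
  have "((\<lambda>k. k * sinh (pi * k) / ((k + p) * sinh (pi * (k + p)))) \<longlongrightarrow> 1 / exp (pi * p)) at_top"
    using assms unfolding sinh_field_def by real_asymp
  then have "(\<lambda>n. (\<lambda>k. k * sinh (pi * k) / ((k + p) * sinh (pi * (k + p)))) (real (Suc n))) \<longlonglongrightarrow> 1 / exp (pi * p)"
    by (rule filterlim_compose)
      (intro filterlim_compose[OF filterlim_real_sequentially filterlim_Suc])
  then show "(\<lambda>n. (norm (gamma_phase p (real (Suc n))))\<^sup>2) \<longlonglongrightarrow> exp (- pi * p)"
    using assms by (simp add: norm_gamma_phase exp_minus inverse_eq_divide)
qed

lemma continuous_on_gamma_phase:
  assumes "k > 0"
  shows "continuous_on {0<..} (\<lambda>p. gamma_phase p k)"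
proof -
  have "continuous_on {0<..} (\<lambda>p. Gamma (\<i> * complex_of_real (k + p)))"
    by (rule continuous_on_compose2[OF continuous_on_Gamma[of "- \<int>\<^sub>\<le>\<^sub>0"]])
       (use assms in \<open>auto intro!: continuous_intros simp: imaginary_not_nonpos_Int simp del: of_real_add\<close>)
  then show ?thesis
    unfolding gamma_phase_def
    by (intro continuous_intros)
      (use assms imaginary_not_nonpos_Int[of k] in \<open>auto simp: Gamma_eq_zero_iff\<close>)
qed

text \<open>The rate 4 q (1 + q) / k is uniform for q in a bounded interval, so the convergence is
  locally uniform in the momentum and preserves continuity.\<close>

lemma continuous_on_gamma_phase_limit:
  "continuous_on {0<..} gamma_phase_limit"
proof (intro continuous_at_imp_continuous_on ballI)
  fix p :: real assume p: "p \<in> {0<..}"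
  define b where "b = p + 1"
  have "continuous_on {0<..<b} gamma_phase_limit"
  proof (rule uniform_limit_theorem)
    show "uniform_limit {0<..<b} (\<lambda>n q. gamma_phase q (real (Suc n))) gamma_phase_limit sequentially"
    proof (rule uniform_limitI)
      fix e :: real assume e: "e > 0"
      define C where "C = 4 * b * (1 + b)"
      have "(\<lambda>n. C * inverse (real (Suc n))) \<longlonglongrightarrow> C * 0"
        by (intro tendsto_intros LIMSEQ_inverse_real_of_nat)
      then have "eventually (\<lambda>n. C * inverse (real (Suc n)) < e) sequentially"
        using e by (intro order_tendstoD(2)) auto
      then show "eventually (\<lambda>n. \<forall>q\<in>{0<..<b}. dist (gamma_phase q (real (Suc n))) (gamma_phase_limit q) < e) sequentially"
      proof (eventually_elim, intro ballI)
        fix n q assume n: "C * inverse (real (Suc n)) < e" and q: "q \<in> {0<..<b}"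
        have "norm (gamma_phase q (real (Suc n)) - gamma_phase_limit q) \<le> 4 * q * (1 + q) / real (Suc n)"
          using q by (intro gamma_phase_limit_error) auto
        also have "\<dots> \<le> C / real (Suc n)"
          using q unfolding C_def by (intro divide_right_mono mult_mono) auto
        finally show "dist (gamma_phase q (real (Suc n))) (gamma_phase_limit q) < e"
          using n by (simp add: dist_norm divide_inverse)
      qed
    qed
    show "eventually (\<lambda>n. continuous_on {0<..<b} (\<lambda>q. gamma_phase q (real (Suc n)))) sequentially"
      by (intro always_eventually allI continuous_on_subset[OF continuous_on_gamma_phase]) auto
  qed simp
  then show "isCont gamma_phase_limit p"
    by (rule continuous_on_interior) (use p in \<open>auto simp: b_def\<close>)
qed

subsection \<open>The amplitude of a wave packet behind the coordinate change\<close>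

text \<open>The Beta function at i (k + p) and - i p: the boundary value of the logistic Beta
  integral when the real parts of both parameters tend to 0.\<close>

definition rindler_amplitude :: "real \<Rightarrow> real \<Rightarrow> complex" where
  "rindler_amplitude p k = Gamma (- (\<i> * of_real p)) * Gamma (\<i> * of_real (k + p)) / Gamma (\<i> * of_real k)"

lemma rindler_amplitude_eq:
  "rindler_amplitude p k = Gamma (- (\<i> * of_real p)) * gamma_phase p k * cis (p * ln k)"
  by (simp add: rindler_amplitude_def gamma_phase_def cis_mult mult.assoc)

text \<open>Conjugation reduces this to \<open>norm_Gamma_imaginary\<close>; the simple bound then
  follows from x \<le> sinh x.\<close>

lemma norm_Gamma_minus_imaginary:
  assumes "p > 0"
  shows "(norm (Gamma (- (\<i> * of_real p))))\<^sup>2 = pi / (p * sinh (pi * p))"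
    and "norm (Gamma (- (\<i> * of_real p))) \<le> 1 / p"
proof -
  have "Gamma (- (\<i> * of_real p)) = cnj (Gamma (\<i> * of_real p))" by (simp add: cnj_Gamma)
  then show eq: "(norm (Gamma (- (\<i> * of_real p))))\<^sup>2 = pi / (p * sinh (pi * p))"
    by (simp only: complex_mod_cnj norm_Gamma_imaginary[OF assms])
  have "pi * p \<le> sinh (pi * p)"
    using real_le_x_sinh[of "pi * p"] assms by (simp add: sinh_field_def exp_minus)
  then have "pi / (p * sinh (pi * p)) \<le> pi / (p * (pi * p))"
    using assms by (intro divide_left_mono mult_left_mono mult_pos_pos) auto
  also have "\<dots> = (1 / p)\<^sup>2" using assms by (simp add: power2_eq_square)
  finally show "norm (Gamma (- (\<i> * of_real p))) \<le> 1 / p"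
    unfolding eq[symmetric] by (rule power2_le_imp_le) (use assms in simp)
qed

text \<open>The factor \<open>sqrt k\<close> compensates the weight 1 / k of the particle number
  near k = 0.\<close>

lemma norm_rindler_amplitude_le:
  assumes "p > 0" "k > 0"
  shows "norm (rindler_amplitude p k) \<le> sqrt (k / p) / p"
proof -
  have "norm (gamma_phase p k) \<le> sqrt (k / (k + p))"
    using norm_gamma_phase_le(1)[OF assms] by (rule real_le_rsqrt)
  also have "\<dots> \<le> sqrt (k / p)"
    using assms by (simp add: frac_le)
  finally have "norm (Gamma (- (\<i> * of_real p))) * norm (gamma_phase p k) \<le> 1 / p * sqrt (k / p)"
    using assms by (intro mult_mono norm_Gamma_minus_imaginary) auto
  then show ?thesis by (simp add: rindler_amplitude_eq norm_mult)
qed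

text \<open>The bound 1 / p on the Gamma factor cancels the p in the convergence rate of
  \<open>gamma_phase\<close>.\<close>

lemma rindler_amplitude_asymptotic:
  assumes "p > 0" "1 \<le> k"
  shows "norm (rindler_amplitude p k - Gamma (- (\<i> * of_real p)) * gamma_phase_limit p * cis (p * ln k))
      \<le> 4 * (1 + p) / k"
proof -
  have "rindler_amplitude p k - Gamma (- (\<i> * of_real p)) * gamma_phase_limit p * cis (p * ln k) =
    Gamma (- (\<i> * of_real p)) * (gamma_phase p k - gamma_phase_limit p) * cis (p * ln k)"
    by (simp add: rindler_amplitude_eq algebra_simps)
  then have "norm (rindler_amplitude p k - Gamma (- (\<i> * of_real p)) * gamma_phase_limit p * cis (p * ln k)) =
     norm (Gamma (- (\<i> * of_real p))) * norm (gamma_phase p k - gamma_phase_limit p)"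
    by (simp add: norm_mult)
  also have "\<dots> \<le> 1 / p * (4 * p * (1 + p) / k)"
    using assms by (intro mult_mono norm_Gamma_minus_imaginary gamma_phase_limit_error) auto
  also have "\<dots> = 4 * (1 + p) / k" using assms by simp
  finally show ?thesis .
qed

text \<open>A nonzero imaginary part keeps the argument off the poles, also where the real part is
  0, that is, where the regulator is switched off.\<close>

lemma continuous_on_Gamma_vertical:
  fixes u :: "'a::topological_space \<Rightarrow> complex"
  assumes u: "continuous_on S u" and v: "continuous_on S v"
    and v0: "\<And>x. x \<in> S \<Longrightarrow> v x \<noteq> 0" and uR: "\<And>x. x \<in> S \<Longrightarrow> u x \<in> \<real>"
  shows "continuous_on S (\<lambda>x. Gamma (u x + \<i> * of_real (v x)))"
proof (rule continuous_on_compose2[OF continuous_on_Gamma[of "- \<int>\<^sub>\<le>\<^sub>0"]])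
  have "u x + \<i> * of_real (v x) \<notin> \<int>\<^sub>\<le>\<^sub>0" if "x \<in> S" for x
    using v0[OF that] uR[OF that]
    by (auto elim!: nonpos_Ints_cases' Reals_cases simp: complex_eq_iff)
  then show "(\<lambda>x. u x + \<i> * of_real (v x)) ` S \<subseteq> - \<int>\<^sub>\<le>\<^sub>0" by auto
qed (auto intro!: continuous_intros u v)

lemma continuous_on_Gamma_minus_imaginary:
  "continuous_on {0<..} (\<lambda>p. Gamma (- (\<i> * complex_of_real p)))"
  using continuous_on_Gamma_vertical[of "{0<..}" "\<lambda>_. 0" uminus] by (simp add: continuous_intros)

lemma continuous_on_rindler_amplitude:
  assumes "k > 0"
  shows "continuous_on {0<..} (\<lambda>p. rindler_amplitude p k)"
  unfolding rindler_amplitude_eq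
  by (intro continuous_intros continuous_on_Gamma_minus_imaginary continuous_on_gamma_phase assms)

text \<open>\<open>G\<close> may be singular at p \<le> 0, but the product vanishes for p < a, and
  the open sets \<open>{0<..}\<close> and \<open>{..<a}\<close> cover the line.\<close>

lemma continuous_on_mult_compact_support:
  fixes F G :: "real \<Rightarrow> complex"
  assumes F: "continuous_on UNIV F" and supp: "\<And>p. p \<notin> {a..b} \<Longrightarrow> F p = 0"
    and "a > 0" and G: "continuous_on {0<..} G"
  shows "continuous_on UNIV (\<lambda>p. F p * G p)"
proof -
  have "continuous_on ({0<..} \<union> {..<a}) (\<lambda>p. F p * G p)"
  proof (rule continuous_on_open_Un)
    show "continuous_on {0<..} (\<lambda>p. F p * G p)"
      by (intro continuous_intros G continuous_on_subset[OF F]) auto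
    have "continuous_on {..<a} (\<lambda>p. 0 :: complex)" by simp
    then show "continuous_on {..<a} (\<lambda>p. F p * G p)"
      by (rule continuous_on_eq) (simp add: supp)
  qed auto
  moreover have "{0<..} \<union> {..<a} = UNIV" using assms(3) by auto
  ultimately show ?thesis by simp
qed

text \<open>With k = exp s the measure dk / k becomes ds, and k > 1 becomes s > 0.\<close>

lemma LBINT_logarithmic_substitution:
  fixes f :: "real \<Rightarrow> real"
  assumes "integrable lborel f"
  shows "set_integrable lborel {1<..} (\<lambda>k. f (ln k) / k)"
    and "(LBINT k:{1<..}. f (ln k) / k) = (LBINT s:{0<..}. f s)"
proof -
  note [measurable] = borel_measurable_integrable[OF assms]
  let ?g = "\<lambda>k. f (ln k) / k"
  have im: "exp ` {0<..} = {1::real<..}"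
  proof -
    have "x \<in> exp ` {0<..}" if "x > 1" for x :: real
      using that by (intro image_eqI[of _ _ "ln x"]) auto
    then show ?thesis by auto
  qed
  have f: "set_integrable lborel {0<..} f"
    using integrable_mult_indicator[OF _ assms, of "{0<..}"] by (simp add: set_integrable_def)
  then have f': "set_integrable lebesgue {0<..} f"
    unfolding set_integrable_def by (subst integrable_completion) auto
  have "(\<lambda>x. \<bar>exp x\<bar> *\<^sub>R ?g (exp x)) absolutely_integrable_on {0<..} \<and>
      integral {0<..} (\<lambda>x. \<bar>exp x\<bar> *\<^sub>R ?g (exp x)) = (LBINT s:{0<..}. f s)"
    using f' set_borel_integral_eq_integral(2)[OF f] by simp
  then have *: "?g absolutely_integrable_on (exp ` {0<..}) \<and> integral (exp ` {0<..}) ?g = (LBINT s:{0<..}. f s)"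
    by (subst (asm) has_absolute_integral_change_of_variables_real)
       (auto intro!: derivative_eq_intros inj_onI)
  then have "set_integrable lebesgue {1<..} ?g" unfolding im by simp
  then show g: "set_integrable lborel {1<..} ?g"
    unfolding set_integrable_def by (subst (asm) integrable_completion) measurable
  show "(LBINT k:{1<..}. ?g k) = (LBINT s:{0<..}. f s)"
    using * unfolding im set_borel_integral_eq_integral(2)[OF g] by simp
qed

lemma integrable_inverse_1_plus_square:
  "integrable lborel (\<lambda>x. indicator {0<..} x * (C / (1 + x\<^sup>2)) :: real)"
proof -
  have "set_integrable lborel (einterval 0 \<infinity>) (\<lambda>x. inverse (1 + x\<^sup>2) :: real)"
    using integrable_I0i_1_div_plus_square by (simp add: interval_lebesgue_integrable_def inverse_eq_divide)
  moreover have "einterval 0 \<infinity> = {0<..}" by (auto simp: einterval_def)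
  ultimately have "integrable lborel (\<lambda>x. C * (indicator {0<..} x * inverse (1 + x\<^sup>2)) :: real)"
    unfolding set_integrable_def by (intro integrable_mult_right) simp
  then show ?thesis by (simp add: divide_inverse mult_ac)
qed


section \<open>Wave packets with compact spectrum in the positive half-line\<close>

locale wave_packet =
  fixes F :: "real \<Rightarrow> complex" and a b :: real
  assumes a_pos: "0 < a"
    and cont: "continuous_on UNIV F"
    and supp: "p \<notin> {a..b} \<Longrightarrow> F p = 0"
    and integrable_transform: "integrable lborel (\<lambda>y. LINT q|lborel. F q * cis (q * y))"
begin

text \<open>The unshifted packet without its factor (2 pi)^(-1/2).\<close>

definition profile :: "real \<Rightarrow> complex" where
  "profile y = (LINT q|lborel. F q * cis (q * y))"

text \<open>Up to the factor 1 / (2 pi) this is \<open>checkft\<close> of the packet shifted by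
  \<open>yo\<close>.\<close>

definition phase_integral :: "real \<Rightarrow> real \<Rightarrow> complex" where
  "phase_integral yo k = (LINT y|lborel. profile (y - yo) * cis (k * xmap y))"

text \<open>What survives of spectrum times amplitude for large k once exp (i p ln k) is split off.
  Since \<open>F\<close> vanishes below a > 0, the pole of the Gamma factor at p = 0 does no
  harm.\<close>

definition weighted_spectrum :: "real \<Rightarrow> complex" where
  "weighted_spectrum p = F p * (Gamma (- (\<i> * of_real p)) * gamma_phase_limit p)"

text \<open>The function m of the outline above, to be evaluated at s = ln k - yo.\<close>

definition asymptotic_profile :: "real \<Rightarrow> complex" where
  "asymptotic_profile s = (LINT p|lborel. weighted_spectrum p * cis (p * s))"

lemma integrable_profile: "integrable lborel profile"
  unfolding profile_def[abs_def] by (rule integrable_transform)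

lemma profile_measurable[measurable]: "profile \<in> borel_measurable borel"
  using borel_measurable_integrable[OF integrable_profile] by simp

lemma integrable_F: "integrable lborel F"
  using continuous_compact_support[OF cont supp] by blast

lemma F_measurable[measurable]: "F \<in> borel_measurable borel"
  using cont by (rule borel_measurable_continuous_onI)

lemma continuous_weighted_spectrum: "continuous_on UNIV weighted_spectrum"
  unfolding weighted_spectrum_def
  by (intro continuous_on_mult_compact_support[OF cont supp a_pos] continuous_intros
      continuous_on_Gamma_minus_imaginary continuous_on_gamma_phase_limit)

lemma supp_weighted_spectrum: "p \<notin> {a..b} \<Longrightarrow> weighted_spectrum p = 0"
  by (simp add: weighted_spectrum_def supp)

lemma integrable_weighted_spectrum: "integrable lborel weighted_spectrum"
  using continuous_compact_support[OF continuous_weighted_spectrum supp_weighted_spectrum] by blast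

lemma asymptotic_profile_measurable[measurable]: "asymptotic_profile \<in> borel_measurable borel"
  unfolding asymptotic_profile_def[abs_def] by (rule fourier_integral_measurable[OF integrable_weighted_spectrum])

lemma norm_asymptotic_profile_le: "norm (asymptotic_profile s) \<le> (LINT p|lborel. norm (weighted_spectrum p))"
  unfolding asymptotic_profile_def by (rule norm_fourier_integral_le[OF integrable_weighted_spectrum])

lemma xmap_measurable[measurable]: "xmap \<in> borel_measurable borel"
  unfolding xmap_def[abs_def] by measurable

lemma phase_integral_measurable[measurable]: "phase_integral yo \<in> borel_measurable borel"
  unfolding phase_integral_def[abs_def] by measurable

text \<open>The phase integral over \<open>y\<close> converges only conditionally, hence the regulator
  \<open>exp (- \<epsilon> y) (1 + exp (- y)) ^ (- 2 \<epsilon>)\<close>, which takes values in \<open>(0, 1]\<close> and keeps the integral of Beta type.\<close>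

lemma regularised_phase_integral:
  assumes e: "e > 0" and k: "k > 0"
  shows "(LINT y|lborel. profile (y - yo) * cis (k * xmap y) * of_real (exp (e * (2 * xmap y - y)))) =
    (LINT q|lborel. (F q * cis (- q * yo)) *
      (Gamma (of_real e + \<i> * of_real (k + q)) * Gamma (of_real e - \<i> * of_real q) / Gamma (2 * of_real e + \<i> * of_real k)))"
proof -
  let ?g = "\<lambda>y. cis (k * xmap y) * complex_of_real (exp (e * (2 * xmap y - y)))"
  \<comment> \<open>With t = exp (xmap y) the regulator is (t (1 - t))^e, which adds e to both Beta
    parameters and makes their real parts positive.\<close>
  have beta: "?g y * cis (q * y) = exp (- (of_real e - \<i> * of_real q) * of_real y
      - ((of_real e + \<i> * of_real (k + q)) + (of_real e - \<i> * of_real q)) * of_real (ln (1 + exp (- y))))" for q y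
    by (simp add: cis_conv_exp exp_of_real[symmetric] exp_add[symmetric] xmap_def algebra_simps)
  \<comment> \<open>The case q = 0 of the Beta integral provides the integrability of the regulated
    phase.\<close>
  have "integrable lborel (\<lambda>y. ?g y * cis (0 * y))"
    unfolding beta by (rule Beta_integral_logistic) (use e in auto)
  then have g: "integrable lborel ?g" by simp
  have 1: "(LINT y|lborel. ?g y * (LINT q|lborel. (F q * cis (- q * yo)) * cis (q * y))) =
        (LINT q|lborel. (F q * cis (- q * yo)) * (LINT y|lborel. ?g y * cis (q * y)))"
    by (rule integral_swap_kernel[OF g, of _ _ 1]) (auto intro!: integrable_mult_cis integrable_F)
  have 2: "(LINT y|lborel. ?g y * cis (q * y)) = Gamma (of_real e + \<i> * of_real (k + q)) * Gamma (of_real e - \<i> * of_real q) /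
       Gamma (2 * of_real e + \<i> * of_real k)" for q
    unfolding beta by (subst Beta_integral_logistic) (use e in \<open>auto simp: algebra_simps\<close>)
  have 3: "(LINT q|lborel. (F q * cis (- q * yo)) * cis (q * y)) = profile (y - yo)" for y
    unfolding profile_def by (simp add: mult.assoc cis_mult algebra_simps)
  have 4: "profile (y - yo) * cis (k * xmap y) * of_real (exp (e * (2 * xmap y - y))) = ?g y * profile (y - yo)" for y
    by (simp only: mult_ac)
  show ?thesis using 1 unfolding 2 3 4 .
qed

lemma regulator_bounds: "0 \<le> e \<Longrightarrow> exp (e * (2 * xmap y - y)) \<le> 1"
proof -
  assume e: "0 \<le> e"
  have "ln (exp (- y)) \<le> ln (1 + exp (- y))"
    by (rule ln_mono) (simp_all add: add_pos_pos)
  then have "- y \<le> ln (1 + exp (- y))" by simp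
  moreover have "0 \<le> ln (1 + exp (- y))" by (rule ln_ge_zero) simp
  ultimately have "2 * xmap y - y \<le> 0" unfolding xmap_def by linarith
  then show ?thesis using e by (simp add: mult_nonneg_nonpos)
qed

text \<open>The regulator is removed along e = 1 / (n + 1) on both sides of
  \<open>regularised_phase_integral\<close>. On the left the profile dominates; on the right the
  Beta factor is bounded uniformly in e over the support of \<open>F\<close>.\<close>

lemma phase_integral_eq:
  assumes k: "k > 0"
  shows "phase_integral yo k = (LINT p|lborel. (F p * rindler_amplitude p k) * cis (p * (- yo)))"
proof (rule LIMSEQ_unique)
  let ?e = "\<lambda>n. inverse (real (Suc n))"
  let ?B = "\<lambda>e q. Gamma (of_real e + \<i> * of_real (k + q)) * Gamma (of_real e - \<i> * of_real q) / Gamma (2 * of_real e + \<i> * of_real k)"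
  let ?r = "\<lambda>n y. complex_of_real (exp (?e n * (2 * xmap y - y)))"
  have e0: "?e \<longlonglongrightarrow> 0" by (rule LIMSEQ_inverse_real_of_nat)
  show "(\<lambda>n. LINT y|lborel. profile (y - yo) * cis (k * xmap y) * ?r n y) \<longlonglongrightarrow> phase_integral yo k"
    unfolding phase_integral_def
  proof (rule integral_dominated_convergence[where w="\<lambda>y. norm (profile (y - yo))"])
    show "AE y in lborel. (\<lambda>n. profile (y - yo) * cis (k * xmap y) * ?r n y) \<longlonglongrightarrow> profile (y - yo) * cis (k * xmap y)"
    proof (rule AE_I2)
      fix y
      have "(\<lambda>n. profile (y - yo) * cis (k * xmap y) * ?r n y) \<longlonglongrightarrow>
         profile (y - yo) * cis (k * xmap y) * complex_of_real (exp (0 * (2 * xmap y - y)))"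
        by (intro tendsto_intros e0)
      then show "(\<lambda>n. profile (y - yo) * cis (k * xmap y) * ?r n y) \<longlonglongrightarrow> profile (y - yo) * cis (k * xmap y)" by simp
    qed
    show "AE y in lborel. norm (profile (y - yo) * cis (k * xmap y) * ?r n y) \<le> norm (profile (y - yo))" for n
      using regulator_bounds[of "?e n"] by (intro AE_I2) (simp add: norm_mult mult_left_le)
    show "integrable lborel (\<lambda>y. norm (profile (y - yo)))"
      using lborel_integrable_real_affine[OF integrable_profile, of 1 "- yo"] by simp
  qed measurable
  \<comment> \<open>The rectangle includes e = 0, where the Gamma arguments are imaginary; k > 0 and
    a > 0 keep them away from 0. Compactness then yields the uniform bound.\<close>
  have contB: "continuous_on ({0..1} \<times> {a..b}) (\<lambda>(e, q). ?B e q)"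
  proof -
    have 1: "continuous_on ({0..1} \<times> {a..b}) (\<lambda>x. Gamma (of_real (fst x) + \<i> * of_real (k + snd x)))"
      by (rule continuous_on_Gamma_vertical) (use k a_pos in \<open>auto intro!: continuous_intros\<close>)
    have 2: "continuous_on ({0..1} \<times> {a..b}) (\<lambda>x. Gamma (of_real (fst x) + \<i> * of_real (- snd x)))"
      by (rule continuous_on_Gamma_vertical) (use k a_pos in \<open>auto intro!: continuous_intros\<close>)
    have 3: "continuous_on ({0..1} \<times> {a..b}) (\<lambda>x. Gamma (2 * of_real (fst x) + \<i> * of_real k))"
      by (rule continuous_on_Gamma_vertical) (use k a_pos in \<open>auto intro!: continuous_intros\<close>)
    have "Gamma (2 * of_real (fst x) + \<i> * of_real k) \<noteq> 0" for x :: "real \<times> real"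
      using k by (auto simp: Gamma_eq_zero_iff elim!: nonpos_Ints_cases' dest!: arg_cong[of _ _ Im])
    then have "continuous_on ({0..1} \<times> {a..b}) (\<lambda>x. Gamma (of_real (fst x) + \<i> * of_real (k + snd x)) *
         Gamma (of_real (fst x) + \<i> * of_real (- snd x)) / Gamma (2 * of_real (fst x) + \<i> * of_real k))"
      by (intro continuous_intros 1 2 3) auto
    then show ?thesis by (simp add: split_beta)
  qed
  have "bounded ((\<lambda>(e, q). ?B e q) ` ({0..1} \<times> {a..b}))"
    by (intro compact_imp_bounded compact_continuous_image contB compact_Times) auto
  then obtain C where C: "\<And>e q. e \<in> {0..1} \<Longrightarrow> q \<in> {a..b} \<Longrightarrow> norm (?B e q) \<le> C"
    unfolding bounded_iff by fastforce
  have e01: "?e n \<in> {0..1}" for n by (auto simp: inverse_eq_divide)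
  have "(\<lambda>n. LINT q|lborel. (F q * cis (- q * yo)) * ?B (?e n) q) \<longlonglongrightarrow>
      (LINT q|lborel. (F q * cis (- q * yo)) * rindler_amplitude q k)"
  proof (rule integral_dominated_convergence[where w="\<lambda>q. norm (F q) * C"])
    show "AE q in lborel. (\<lambda>n. (F q * cis (- q * yo)) * ?B (?e n) q) \<longlonglongrightarrow> (F q * cis (- q * yo)) * rindler_amplitude q k"
    proof (rule AE_I2)
      fix q
      show "(\<lambda>n. (F q * cis (- q * yo)) * ?B (?e n) q) \<longlonglongrightarrow> (F q * cis (- q * yo)) * rindler_amplitude q k"
      proof (cases "q \<in> {a..b}")
        case True
        have "continuous_on {0..1} (\<lambda>e. (\<lambda>(e, q). ?B e q) (e, q))"
          by (rule continuous_on_compose2[OF contB]) (use True in \<open>auto intro!: continuous_intros\<close>)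
        then have "(\<lambda>n. ?B (?e n) q) \<longlonglongrightarrow> ?B 0 q"
          by (intro continuous_on_tendsto_compose[where f="\<lambda>e. ?B e q" and s="{0..1}"] e0)
             (use e01 in \<open>auto simp: split_beta\<close>)
        then have "(\<lambda>n. ?B (?e n) q) \<longlonglongrightarrow> rindler_amplitude q k"
          by (simp add: rindler_amplitude_def mult_ac)
        then show ?thesis by (intro tendsto_intros)
      qed (simp add: supp)
    qed
    show "AE q in lborel. norm ((F q * cis (- q * yo)) * ?B (?e n) q) \<le> norm (F q) * C" for n
    proof (rule AE_I2)
      fix q
      show "norm ((F q * cis (- q * yo)) * ?B (?e n) q) \<le> norm (F q) * C"
      proof (cases "q \<in> {a..b}")
        case True
        have "norm (F q * cis (- q * yo)) * norm (?B (?e n) q) \<le> norm (F q) * C"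
          by (intro mult_mono C[OF e01 True]) (auto simp: norm_mult)
        then show ?thesis by (simp only: norm_mult)
      qed (simp add: supp)
    qed
    show "integrable lborel (\<lambda>q. norm (F q) * C)" using integrable_F by simp
    have "continuous_on UNIV (\<lambda>q. F q * rindler_amplitude q k)"
      by (rule continuous_on_mult_compact_support[OF cont supp a_pos continuous_on_rindler_amplitude[OF k]])
    then have [measurable]: "(\<lambda>q. F q * rindler_amplitude q k) \<in> borel_measurable borel"
      by (rule borel_measurable_continuous_onI)
    have "(\<lambda>q. (F q * rindler_amplitude q k) * cis (- q * yo)) \<in> borel_measurable lborel" by measurable
    then show "(\<lambda>q. (F q * cis (- q * yo)) * rindler_amplitude q k) \<in> borel_measurable lborel"
      by (simp add: mult_ac)
    fix n
    let ?G = "\<lambda>q. ?B (?e n) q"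
    have 1: "continuous_on {0<..} (\<lambda>q. Gamma (of_real (?e n) + \<i> * of_real (k + q)))"
      by (rule continuous_on_Gamma_vertical) (use k in \<open>auto intro!: continuous_intros\<close>)
    have 2: "continuous_on {0<..} (\<lambda>q. Gamma (of_real (?e n) + \<i> * of_real (- q)))"
      by (rule continuous_on_Gamma_vertical) (auto intro!: continuous_intros)
    have "continuous_on {0<..} (\<lambda>q. Gamma (of_real (?e n) + \<i> * of_real (k + q)) *
         Gamma (of_real (?e n) + \<i> * of_real (- q)) * inverse (Gamma (2 * of_real (?e n) + \<i> * of_real k)))"
      by (intro continuous_on_mult continuous_on_const 1 2)
    then have "continuous_on {0<..} ?G" by (simp add: divide_inverse)
    from continuous_on_mult_compact_support[OF cont supp a_pos this]
    have [measurable]: "(\<lambda>q. F q * ?G q) \<in> borel_measurable borel"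
      by (rule borel_measurable_continuous_onI)
    have "(\<lambda>q. (F q * ?G q) * cis (- q * yo)) \<in> borel_measurable lborel" by measurable
    then show "(\<lambda>q. (F q * cis (- q * yo)) * ?B (?e n) q) \<in> borel_measurable lborel"
      by (simp add: mult_ac)
  qed
  then show "(\<lambda>n. LINT y|lborel. profile (y - yo) * cis (k * xmap y) * ?r n y) \<longlonglongrightarrow>
      (LINT p|lborel. (F p * rindler_amplitude p k) * cis (p * (- yo)))"
    by (subst regularised_phase_integral) (use k in \<open>simp_all add: mult_ac\<close>)
qed

section \<open>Decay, bounds and asymptotics of the phase integral\<close>

lemma asymptotic_profile_tendsto_0:
  assumes "filterlim (\<lambda>n. \<bar>X n\<bar>) at_top sequentially"
  shows "(\<lambda>n. asymptotic_profile (X n)) \<longlonglongrightarrow> 0"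
  unfolding asymptotic_profile_def by (rule riemann_lebesgue[OF continuous_weighted_spectrum supp_weighted_spectrum assms])

lemma phase_integral_tendsto_0:
  assumes k: "k > 0" and X: "filterlim (\<lambda>n. \<bar>X n\<bar>) at_top sequentially"
  shows "(\<lambda>n. phase_integral (X n) k) \<longlonglongrightarrow> 0"
  unfolding phase_integral_eq[OF k]
proof (rule riemann_lebesgue[where a=a and b=b])
  show "continuous_on UNIV (\<lambda>p. F p * rindler_amplitude p k)"
    by (rule continuous_on_mult_compact_support[OF cont supp a_pos continuous_on_rindler_amplitude[OF k]])
  show "filterlim (\<lambda>n. \<bar>- X n\<bar>) at_top sequentially" using X by simp
qed (simp add: supp)

lemma integrable_F_amplitude:
  assumes "k > 0"
  shows "integrable lborel (\<lambda>p. (F p * rindler_amplitude p k) * cis (p * u))"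
proof -
  have "integrable lborel (\<lambda>p. F p * rindler_amplitude p k)"
    by (rule continuous_compact_support[of _ a b])
       (use supp in \<open>auto intro: continuous_on_mult_compact_support[OF cont supp a_pos
          continuous_on_rindler_amplitude[OF assms]]\<close>)
  then show ?thesis by (rule integrable_mult_cis) simp
qed

text \<open>On the support p \<ge> a, so the amplitude is at most a fixed multiple of
  \<open>sqrt k\<close>; the translation \<open>yo\<close> enters only through a phase.\<close>

lemma norm_phase_integral_le:
  assumes k: "k > 0"
  shows "norm (phase_integral yo k) \<le> (LINT p|lborel. norm (F p)) / (a * sqrt a) * sqrt k"
proof -
  have "norm (phase_integral yo k) \<le> (LINT p|lborel. norm ((F p * rindler_amplitude p k) * cis (p * (- yo))))"
    unfolding phase_integral_eq[OF k] by (rule integral_norm_bound)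
  also have "\<dots> \<le> (LINT p|lborel. norm (F p) * (sqrt k / (a * sqrt a)))"
  proof (rule integral_mono')
    show "integrable lborel (\<lambda>p. norm (F p) * (sqrt k / (a * sqrt a)))" using integrable_F by simp
    fix p
    show "norm ((F p * rindler_amplitude p k) * cis (p * (- yo))) \<le> norm (F p) * (sqrt k / (a * sqrt a))"
    proof (cases "p \<in> {a..b}")
      case True
      then have p: "0 < p" "a \<le> p" using a_pos by auto
      have "norm (rindler_amplitude p k) \<le> sqrt (k / p) / p"
        by (rule norm_rindler_amplitude_le[OF p(1) k])
      also have "\<dots> = sqrt k / (p * sqrt p)" by (simp add: real_sqrt_divide)
      also have "\<dots> \<le> sqrt k / (a * sqrt a)"
        using p a_pos k by (intro divide_left_mono mult_mono mult_pos_pos) auto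
      finally show ?thesis
        using mult_left_mono[OF _ norm_ge_zero[of "F p"]] by (simp only: norm_mult norm_cis mult_1_right)
    qed (use a_pos k in \<open>simp add: supp\<close>)
    show "0 \<le> norm (F p) * (sqrt k / (a * sqrt a))" using a_pos k by simp
  qed
  finally show ?thesis by simp
qed

text \<open>The translation and the oscillation in ln k combine into the single phase p (ln k - yo).
  What is left is the amplitude error integrated against \<open>F\<close>, hence a bound uniform in
  \<open>yo\<close>.\<close>

lemma phase_integral_asymptotic:
  assumes k: "k \<ge> 1"
  shows "norm (phase_integral yo k - asymptotic_profile (ln k - yo)) \<le> 4 * (1 + b) * (LINT p|lborel. norm (F p)) / k"
proof -
  let ?L = "\<lambda>p. Gamma (- (\<i> * of_real p)) * gamma_phase_limit p"
  have k0: "k > 0" using k by simp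
  have "integrable lborel (\<lambda>p. (F p * rindler_amplitude p k) * cis (p * (- yo)))"
    by (rule integrable_F_amplitude[OF k0])
  moreover have "integrable lborel (\<lambda>p. weighted_spectrum p * cis (p * (ln k - yo)))"
    by (rule integrable_mult_cis[OF integrable_weighted_spectrum]) simp
  ultimately have "phase_integral yo k - asymptotic_profile (ln k - yo) =
     (LINT p|lborel. (F p * rindler_amplitude p k) * cis (p * (- yo)) - weighted_spectrum p * cis (p * (ln k - yo)))"
    unfolding phase_integral_eq[OF k0] asymptotic_profile_def by (rule Bochner_Integration.integral_diff[symmetric])
  then have "norm (phase_integral yo k - asymptotic_profile (ln k - yo)) =
     norm (LINT p|lborel. (F p * rindler_amplitude p k) * cis (p * (- yo)) - weighted_spectrum p * cis (p * (ln k - yo)))"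
    by (rule arg_cong)
  also have "\<dots> \<le> (LINT p|lborel. norm ((F p * rindler_amplitude p k) * cis (p * (- yo)) - weighted_spectrum p * cis (p * (ln k - yo))))"
    by (rule integral_norm_bound)
  also have "\<dots> \<le> (LINT p|lborel. norm (F p) * (4 * (1 + b) / k))"
  proof (rule integral_mono')
    show "integrable lborel (\<lambda>p. norm (F p) * (4 * (1 + b) / k))" using integrable_F by simp
    fix p
    have "norm ((F p * rindler_amplitude p k) * cis (p * (- yo)) - weighted_spectrum p * cis (p * (ln k - yo))) \<le> norm (F p) * (4 * (1 + b) / k)
        \<and> 0 \<le> norm (F p) * (4 * (1 + b) / k)"
    proof (cases "p \<in> {a..b}")
      case True
      then have p: "0 < p" "p \<le> b" using a_pos by auto
      have "(F p * rindler_amplitude p k) * cis (p * (- yo)) - weighted_spectrum p * cis (p * (ln k - yo)) =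
         F p * (rindler_amplitude p k - ?L p * cis (p * ln k)) * cis (p * (- yo))"
      proof -
        have "cis (p * (ln k - yo)) = cis (p * ln k) * cis (p * (- yo))"
          by (simp add: cis_mult algebra_simps)
        then show ?thesis unfolding weighted_spectrum_def by (simp only: left_diff_distrib right_diff_distrib mult.assoc)
      qed
      then have "norm ((F p * rindler_amplitude p k) * cis (p * (- yo)) - weighted_spectrum p * cis (p * (ln k - yo))) =
         norm (F p) * norm (rindler_amplitude p k - ?L p * cis (p * ln k))"
        by (simp only: norm_mult norm_cis mult_1_right)
      also have "\<dots> \<le> norm (F p) * (4 * (1 + p) / k)"
        by (intro mult_left_mono rindler_amplitude_asymptotic p k) simp
      also have "\<dots> \<le> norm (F p) * (4 * (1 + b) / k)"
        using p k by (intro mult_left_mono divide_right_mono) auto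
      finally show ?thesis using p k by simp
    qed (simp add: supp supp_weighted_spectrum)
    then show "norm ((F p * rindler_amplitude p k) * cis (p * (- yo)) - weighted_spectrum p * cis (p * (ln k - yo))) \<le> norm (F p) * (4 * (1 + b) / k)"
      and "0 \<le> norm (F p) * (4 * (1 + b) / k)" by blast+
  qed
  finally show ?thesis by (simp add: mult_ac)
qed

text \<open>The asymptotic part is subtracted only for k > 1, where the error estimate of order 1 /
  k is available.\<close>

definition remainder :: "real \<Rightarrow> real \<Rightarrow> real" where
  "remainder yo k = indicator {0<..} k *
     (((norm (phase_integral yo k))\<^sup>2 - indicator {1<..} k * (norm (asymptotic_profile (ln k - yo)))\<^sup>2) / (2 * k))"

lemma remainder_measurable[measurable]: "remainder yo \<in> borel_measurable borel"
  unfolding remainder_def[abs_def] by measurable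

text \<open>The majorant must not depend on \<open>yo\<close>. For k \<le> 1 the
  \<open>sqrt k\<close> bound cancels the weight 1 / k. For k > 1 the difference of squares is a
  difference of order 1 / k times a bounded sum, and the weight supplies another 1 / k.\<close>

lemma remainder_dominated:
  obtains C where "\<And>yo k. \<bar>remainder yo k\<bar> \<le> indicator {0<..} k * (C / (1 + k\<^sup>2))"
proof -
  define A where "A = (LINT p|lborel. norm (F p)) / (a * sqrt a)"
  define B where "B = (LINT p|lborel. norm (weighted_spectrum p))"
  define D where "D = 4 * (1 + b) * (LINT p|lborel. norm (F p))"
  \<comment> \<open>The first summand covers k \<le> 1, the second k > 1. The modulus of D is taken
    because the locale leaves the sign of 1 + b open.\<close>
  define C where "C = A\<^sup>2 + \<bar>D\<bar> * (2 * B + \<bar>D\<bar>)"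
  have B: "B \<ge> 0" by (simp add: B_def)
  have "\<bar>remainder yo k\<bar> \<le> indicator {0<..} k * (C / (1 + k\<^sup>2))" for yo k
  proof -
    consider "k \<le> 0" | "0 < k" "k \<le> 1" | "1 < k" by linarith
    then show ?thesis
    proof cases
      case 1
      then show ?thesis by (simp add: remainder_def)
    next
      case 2
      have k2: "k\<^sup>2 \<le> 1" using 2 by (simp add: power_le_one)
      have "(norm (phase_integral yo k))\<^sup>2 \<le> (A * sqrt k)\<^sup>2"
        unfolding A_def by (intro power_mono norm_phase_integral_le 2) simp
      also have "\<dots> = A\<^sup>2 * k" using 2 by (simp add: power_mult_distrib)
      finally have "(norm (phase_integral yo k))\<^sup>2 / (2 * k) \<le> A\<^sup>2 / 2"
        using 2 by (simp add: field_simps)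
      \<comment> \<open>Here 1 + k^2 \<le> 2.\<close>
      also have "\<dots> \<le> A\<^sup>2 / (1 + k\<^sup>2)"
        using k2 by (intro divide_left_mono) (auto simp: add_pos_nonneg)
      also have "\<dots> \<le> C / (1 + k\<^sup>2)"
        unfolding C_def using B by (intro divide_right_mono) auto
      finally show ?thesis using 2 by (simp add: remainder_def)
    next
      case 3
      let ?m = "asymptotic_profile (ln k - yo)"
      have r: "norm (phase_integral yo k - ?m) \<le> \<bar>D\<bar> / k"
        using phase_integral_asymptotic[of k yo] 3 abs_ge_self[of D] divide_right_mono[of D "\<bar>D\<bar>" k] unfolding D_def by linarith
      have "\<bar>D\<bar> * 1 \<le> \<bar>D\<bar> * k" using 3 by (intro mult_left_mono) auto
      then have "\<bar>D\<bar> / k \<le> \<bar>D\<bar>" using 3 by (simp add: divide_le_eq)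
      then have cb: "norm (phase_integral yo k) + norm ?m \<le> 2 * B + \<bar>D\<bar>"
        using norm_triangle_sub[of "phase_integral yo k" ?m] r norm_asymptotic_profile_le[of "ln k - yo"] unfolding B_def by linarith
      have "\<bar>(norm (phase_integral yo k))\<^sup>2 - (norm ?m)\<^sup>2\<bar> = \<bar>norm (phase_integral yo k) - norm ?m\<bar> * (norm (phase_integral yo k) + norm ?m)"
        by (simp add: power2_eq_square square_diff_square_factored abs_mult mult.commute)
      also have "\<dots> \<le> (\<bar>D\<bar> / k) * (2 * B + \<bar>D\<bar>)"
        using cb order_trans[OF norm_triangle_ineq3 r] by (intro mult_mono) auto
      finally have "\<bar>(norm (phase_integral yo k))\<^sup>2 - (norm ?m)\<^sup>2\<bar> / (2 * k) \<le> (\<bar>D\<bar> / k) * (2 * B + \<bar>D\<bar>) / (2 * k)"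
        using 3 by (intro divide_right_mono) auto
      also have "\<dots> = \<bar>D\<bar> * (2 * B + \<bar>D\<bar>) / (2 * k\<^sup>2)" by (simp add: power2_eq_square)
      \<comment> \<open>Here 1 + k^2 \<le> 2 k^2.\<close>
      also have "\<dots> \<le> C / (1 + k\<^sup>2)"
        unfolding C_def using B 3 by (intro frac_le) (auto simp: add_pos_nonneg)
      finally show ?thesis using 3 by (simp add: remainder_def abs_divide)
    qed
  qed
  then show ?thesis by (rule that)
qed

lemma integrable_remainder: "integrable lborel (remainder yo)"
proof -
  obtain C where C: "\<And>yo k. \<bar>remainder yo k\<bar> \<le> indicator {0<..} k * (C / (1 + k\<^sup>2))" using remainder_dominated by blast
  show ?thesis
  proof (rule Bochner_Integration.integrable_bound[OF integrable_inverse_1_plus_square[of C]])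
    show "AE k in lborel. norm (remainder yo k) \<le> norm (indicator {0<..} k * (C / (1 + k\<^sup>2)))"
      unfolding real_norm_def by (intro AE_I2 order_trans[OF C abs_ge_self])
  qed simp
qed

text \<open>For fixed k both squared terms vanish in the limit by the Riemann-Lebesgue lemma, and
  the majorant is uniform. Assuming only that the modulus of X diverges serves both directions of
  translation.\<close>

lemma integral_remainder_tendsto_0:
  assumes X: "filterlim (\<lambda>n. \<bar>X n\<bar>) at_top sequentially"
  shows "(\<lambda>n. LINT k|lborel. remainder (X n) k) \<longlonglongrightarrow> 0"
proof -
  obtain C where C: "\<And>yo k. \<bar>remainder yo k\<bar> \<le> indicator {0<..} k * (C / (1 + k\<^sup>2))" using remainder_dominated by blast
  have "(\<lambda>n. LINT k|lborel. remainder (X n) k) \<longlonglongrightarrow> (LINT (k::real)|lborel. 0)"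
  proof (rule integral_dominated_convergence[where w="\<lambda>k. indicator {0<..} k * (C / (1 + k\<^sup>2))"])
    show "AE k in lborel. (\<lambda>n. remainder (X n) k) \<longlonglongrightarrow> 0"
    proof (rule AE_I2)
      fix k :: real
      show "(\<lambda>n. remainder (X n) k) \<longlonglongrightarrow> 0"
      proof (cases "k > 0")
        case True
        have "filterlim (\<lambda>n. \<bar>ln k - X n\<bar>) at_top sequentially"
        proof (rule filterlim_at_top_mono)
          show "filterlim (\<lambda>n. - \<bar>ln k\<bar> + \<bar>X n\<bar>) at_top sequentially"
            by (rule filterlim_tendsto_add_at_top[OF tendsto_const X])
        qed (auto intro!: always_eventually)
        then have "(\<lambda>n. asymptotic_profile (ln k - X n)) \<longlonglongrightarrow> 0" by (rule asymptotic_profile_tendsto_0)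
        moreover have "(\<lambda>n. phase_integral (X n) k) \<longlonglongrightarrow> 0" by (rule phase_integral_tendsto_0[OF True X])
        ultimately have "(\<lambda>n. remainder (X n) k) \<longlonglongrightarrow> indicator {0<..} k *
             (((norm (0::complex))\<^sup>2 - indicator {1<..} k * (norm (0::complex))\<^sup>2) / (2 * k))"
          unfolding remainder_def using True by (intro tendsto_intros) auto
        then show ?thesis by simp
      qed (simp add: remainder_def)
    qed
    show "AE k in lborel. norm (remainder (X n) k) \<le> indicator {0<..} k * (C / (1 + k\<^sup>2))" for n
      using C by (intro AE_I2) simp
    show "integrable lborel (\<lambda>k. indicator {0<..} k * (C / (1 + k\<^sup>2)))"
      by (rule integrable_inverse_1_plus_square)
  qed simp_all
  then show ?thesis by simp
qed

section \<open>Limits of the particle number\<close>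

lemma plancherel_asymptotic_profile:
  shows "integrable lborel (\<lambda>s. (norm (asymptotic_profile s))\<^sup>2)"
    and "(LINT s|lborel. (norm (asymptotic_profile s))\<^sup>2) = 2 * pi * (LINT p|lborel. (norm (weighted_spectrum p))\<^sup>2)"
proof -
  obtain B where "\<And>p. norm (weighted_spectrum p) \<le> B" using continuous_compact_support[OF continuous_weighted_spectrum supp_weighted_spectrum] by blast
  from plancherel[OF integrable_weighted_spectrum continuous_weighted_spectrum this]
  show "integrable lborel (\<lambda>s. (norm (asymptotic_profile s))\<^sup>2)"
    and "(LINT s|lborel. (norm (asymptotic_profile s))\<^sup>2) = 2 * pi * (LINT p|lborel. (norm (weighted_spectrum p))\<^sup>2)"
    unfolding asymptotic_profile_def by blast+
qed

text \<open>In the part subtracted from the remainder, s = ln k absorbs the weight 1 / k and a shift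
  by \<open>yo\<close> frees the integrand of \<open>yo\<close>: only the half-line s > - yo still
  depends on it.\<close>

lemma N_decomposition:
  "(LBINT k:{0<..}. (norm (phase_integral yo k))\<^sup>2 / (2 * k)) =
     (LINT k|lborel. remainder yo k) + (LINT s|lborel. indicator {- yo<..} s * (norm (asymptotic_profile s))\<^sup>2) / 2"
proof -
  let ?f = "\<lambda>s. (norm (asymptotic_profile (s - yo)))\<^sup>2"
  have f: "integrable lborel ?f"
    using lborel_integrable_real_affine[OF plancherel_asymptotic_profile(1), of 1 "- yo"] by simp
  define g where "g = (\<lambda>k. indicator {1<..} k * (?f (ln k) / k) * (1 / 2))"
  have g: "integrable lborel g"
    using LBINT_logarithmic_substitution(1)[OF f] unfolding set_integrable_def real_scaleR_def g_def
    by (rule integrable_mult_left)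
  have "(LBINT k:{0<..}. (norm (phase_integral yo k))\<^sup>2 / (2 * k)) = (LINT k|lborel. remainder yo k + g k)"
    unfolding set_lebesgue_integral_def
    by (intro Bochner_Integration.integral_cong refl)
       (auto simp: remainder_def g_def diff_divide_distrib split: split_indicator)
  also have "\<dots> = (LINT k|lborel. remainder yo k) + (LINT k|lborel. g k)"
    by (rule Bochner_Integration.integral_add[OF integrable_remainder g])
  also have "(LINT k|lborel. g k) = (LBINT k:{1<..}. ?f (ln k) / k) / 2"
    unfolding set_lebesgue_integral_def real_scaleR_def g_def by (subst integral_mult_left_zero) simp
  also have "\<dots> = (LBINT s:{0<..}. ?f s) / 2"
    by (simp only: LBINT_logarithmic_substitution(2)[OF f])
  also have "(LBINT s:{0<..}. ?f s) = (LINT s|lborel. indicator {- yo<..} s * (norm (asymptotic_profile s))\<^sup>2)"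
    unfolding set_lebesgue_integral_def
    by (subst lborel_integral_real_affine[of 1 _ yo])
       (auto intro!: Bochner_Integration.integral_cong split: split_indicator)
  finally show ?thesis .
qed

text \<open>The half-line s > - yo exhausts the real line, and the constant is half of Plancherel's
  2 pi.\<close>

lemma N_tendsto_at_top:
  "((\<lambda>yo. LBINT k:{0<..}. (norm (phase_integral yo k))\<^sup>2 / (2 * k)) \<longlongrightarrow> pi * (LINT p|lborel. (norm (weighted_spectrum p))\<^sup>2)) at_top"
proof (rule tendsto_at_topI_sequentially)
  fix X :: "nat \<Rightarrow> real" assume X: "filterlim X at_top sequentially"
  have "(\<lambda>n. LINT s|lborel. indicator {- X n<..} s * (norm (asymptotic_profile s))\<^sup>2) \<longlonglongrightarrow> (LINT s|lborel. (norm (asymptotic_profile s))\<^sup>2)"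
  proof (rule integral_dominated_convergence[OF _ _ plancherel_asymptotic_profile(1)])
    show "AE s in lborel. (\<lambda>n. indicator {- X n<..} s * (norm (asymptotic_profile s))\<^sup>2) \<longlonglongrightarrow> (norm (asymptotic_profile s))\<^sup>2"
    proof (rule AE_I2)
      fix s :: real
      have "eventually (\<lambda>n. X n > - s) sequentially" using X by (simp add: filterlim_at_top_dense)
      then have "eventually (\<lambda>n. indicator {- X n<..} s * (norm (asymptotic_profile s))\<^sup>2 = (norm (asymptotic_profile s))\<^sup>2) sequentially"
        by eventually_elim (simp add: indicator_def)
      then show "(\<lambda>n. indicator {- X n<..} s * (norm (asymptotic_profile s))\<^sup>2) \<longlonglongrightarrow> (norm (asymptotic_profile s))\<^sup>2"
        by (rule tendsto_eventually)
    qed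
  qed (auto split: split_indicator)
  then have "(\<lambda>n. (LINT k|lborel. remainder (X n) k) + (LINT s|lborel. indicator {- X n<..} s * (norm (asymptotic_profile s))\<^sup>2) / 2)
      \<longlonglongrightarrow> 0 + (LINT s|lborel. (norm (asymptotic_profile s))\<^sup>2) / 2"
    by (intro tendsto_intros integral_remainder_tendsto_0 filterlim_at_top_mono[OF X]) (auto intro!: always_eventually)
  then show "(\<lambda>n. LBINT k:{0<..}. (norm (phase_integral (X n) k))\<^sup>2 / (2 * k)) \<longlonglongrightarrow> pi * (LINT p|lborel. (norm (weighted_spectrum p))\<^sup>2)"
    by (simp add: N_decomposition plancherel_asymptotic_profile(2))
qed

text \<open>The half-line s > - yo eventually leaves every point behind, and the remainder vanishes
  as well.\<close>

lemma N_tendsto_at_bot: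
  "((\<lambda>yo. LBINT k:{0<..}. (norm (phase_integral yo k))\<^sup>2 / (2 * k)) \<longlongrightarrow> 0) at_bot"
  unfolding filterlim_at_bot_mirror
proof (rule tendsto_at_topI_sequentially)
  fix X :: "nat \<Rightarrow> real" assume X: "filterlim X at_top sequentially"
  have "(\<lambda>n. LINT s|lborel. indicator {- (- X n)<..} s * (norm (asymptotic_profile s))\<^sup>2) \<longlonglongrightarrow> (LINT (s::real)|lborel. 0)"
  proof (rule integral_dominated_convergence[OF _ _ plancherel_asymptotic_profile(1)])
    show "AE s in lborel. (\<lambda>n. indicator {- (- X n)<..} s * (norm (asymptotic_profile s))\<^sup>2) \<longlonglongrightarrow> 0"
    proof (rule AE_I2)
      fix s :: real
      have "eventually (\<lambda>n. X n > s) sequentially" using X by (simp add: filterlim_at_top_dense)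
      then have "eventually (\<lambda>n. indicator {- (- X n)<..} s * (norm (asymptotic_profile s))\<^sup>2 = 0) sequentially"
        by eventually_elim (simp add: indicator_def)
      then show "(\<lambda>n. indicator {- (- X n)<..} s * (norm (asymptotic_profile s))\<^sup>2) \<longlonglongrightarrow> 0"
        by (rule tendsto_eventually)
    qed
  qed (auto split: split_indicator)
  then have "(\<lambda>n. (LINT k|lborel. remainder (- X n) k) + (LINT s|lborel. indicator {- (- X n)<..} s * (norm (asymptotic_profile s))\<^sup>2) / 2)
      \<longlonglongrightarrow> 0 + (LINT (s::real)|lborel. 0) / 2"
    by (intro tendsto_intros integral_remainder_tendsto_0 filterlim_at_top_mono[OF X]) (auto intro!: always_eventually)
  then show "(\<lambda>n. LBINT k:{0<..}. (norm (phase_integral (- X n) k))\<^sup>2 / (2 * k)) \<longlonglongrightarrow> 0"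
    by (simp add: N_decomposition)
qed

text \<open>The Planck factor appears because exp (2 pi p) - 1 = 2 sinh (pi p) exp (pi p):
  \<open>sinh\<close> comes from Gamma(- i p), the exponential from
  \<open>gamma_phase_limit\<close>.\<close>

lemma norm_weighted_spectrum_squared:
  "(norm (weighted_spectrum p))\<^sup>2 / (4 * pi) = indicator {0<..} p * ((norm (F p))\<^sup>2 / (2 * p) / (exp (2 * pi * p) - 1))"
proof (cases "p \<in> {a..b}")
  case True
  then have p: "p > 0" using a_pos by auto
  have "exp (2 * pi * p) - 1 = 2 * sinh (pi * p) * exp (pi * p)"
  proof -
    have "exp (2 * pi * p) = exp (pi * p) * exp (pi * p)" by (simp add: exp_add[symmetric])
    moreover have "exp (- (pi * p)) * exp (pi * p) = 1" by (simp add: exp_add[symmetric])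
    ultimately show ?thesis by (simp add: sinh_field_def left_diff_distrib)
  qed
  moreover have "(norm (weighted_spectrum p))\<^sup>2 = (norm (F p))\<^sup>2 * (pi / (p * sinh (pi * p)) * exp (- pi * p))"
    unfolding weighted_spectrum_def by (simp only: norm_mult power_mult_distrib norm_Gamma_minus_imaginary(1)[OF p] norm_gamma_phase_limit[OF p])
  ultimately show ?thesis using p by (simp add: exp_minus field_simps)
qed (use a_pos in \<open>simp add: supp supp_weighted_spectrum\<close>)

end

section \<open>Transfer to admissible packets\<close>

lemma ftil_compact_support:
  assumes "0 < \<delta>" "\<delta> \<le> po" and D: "closure {p. D p \<noteq> 0} \<subseteq> {-\<delta><..<\<delta>}"
  obtains d where "d < po" and "\<And>p. p \<notin> {po - d..po + d} \<Longrightarrow> ftil po D p = 0"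
proof -
  let ?K = "closure {p. D p \<noteq> 0}"
  \<comment> \<open>The closed support is compact inside the open interval, so the maximum d of |p|
    over it is strictly below \<delta>. This leaves a gap po - d > 0 even when \<delta> =
    po.\<close>
  have "bounded ?K" by (rule bounded_subset[OF _ D]) simp
  then have K: "compact ?K" by (simp add: compact_eq_bounded_closed)
  obtain d where d: "d < \<delta>" "\<And>p. p \<in> ?K \<Longrightarrow> \<bar>p\<bar> \<le> d"
  proof (cases "?K = {}")
    case True
    then show ?thesis using that[of 0] assms(1) by auto
  next
    case False
    from continuous_attains_sup[OF K this continuous_on_rabs[OF continuous_on_id]] obtain x where "x \<in> ?K" "\<And>p. p \<in> ?K \<Longrightarrow> \<bar>p\<bar> \<le> \<bar>x\<bar>"
      by blast
    moreover have "x \<in> {-\<delta><..<\<delta>}" using D \<open>x \<in> ?K\<close> by (rule subsetD)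
    then have "\<bar>x\<bar> < \<delta>" by auto
    ultimately show ?thesis using that by blast
  qed
  have "ftil po D p = 0" if "p \<notin> {po - d..po + d}" for p
  proof -
    have "D (p - po) = 0"
    proof (rule ccontr)
      assume "D (p - po) \<noteq> 0"
      then have "p - po \<in> ?K" using closure_subset[of "{p. D p \<noteq> 0}"] by blast
      then have "\<bar>p - po\<bar> \<le> d" by (rule d(2))
      then show False using that by auto
    qed
    then show ?thesis by (simp add: ftil_def)
  qed
  then show ?thesis using that[of d] d(1) assms(2) by simp
qed

lemma Nbar_limits:
  assumes \<delta>: "0 < \<delta>" "\<delta> \<le> po" and adm: "admissible po \<delta> D"
  shows "((\<lambda>yo. Nbar (wave_shift po D yo) - NTh2pi (wave_shift po D yo)) \<longlongrightarrow> 0) at_top"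
    and "((\<lambda>yo. Nbar (wave_shift po D yo)) \<longlongrightarrow> 0) at_bot"
proof -
  define F where "F = (\<lambda>p. complex_of_real (ftil po D p))"
  define s where "s = complex_of_real (1 / sqrt (2 * pi))"
  have s2: "s * s = complex_of_real (1 / (2 * pi))"
    unfolding s_def of_real_mult[symmetric] by simp
  have s0: "s \<noteq> 0" by (simp add: s_def)
  from adm have supp: "closure {p. D p \<noteq> 0} \<subseteq> {-\<delta><..<\<delta>}" and iw: "integrable lborel (wave po D)"
    unfolding admissible_def by auto
  \<comment> \<open>Continuity of the spectrum is the case of derivative order 0 in condition
    (iii).\<close>
  from adm have "continuous_on UNIV ((deriv ^^ 0) (ftil po D))"
    unfolding admissible_def Let_def by blast
  then have cont: "continuous_on UNIV F"
    unfolding F_def by (auto intro!: continuous_intros)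
  obtain d where d: "d < po" and sd: "\<And>p. p \<notin> {po - d..po + d} \<Longrightarrow> ftil po D p = 0"
    using ftil_compact_support[OF \<delta> supp] by blast
  have wave: "wave po D = (\<lambda>y. s * (LINT q|lborel. F q * cis (q * y)))"
    by (simp add: wave_def F_def s_def fun_eq_iff)
  interpret wave_packet F "po - d" "po + d"
  proof
    show "integrable lborel (\<lambda>y. LINT q|lborel. F q * cis (q * y))"
      using integrable_mult_right[OF iw, of "inverse s"]
      unfolding wave mult.assoc[symmetric] left_inverse[OF s0] mult_1_left .
  qed (use d cont sd in \<open>auto simp: F_def\<close>)
  have wave_profile: "wave po D y = s * profile y" for y
    unfolding wave profile_def ..
  have checkft: "checkft (wave_shift po D yo) k = complex_of_real (1 / (2 * pi)) * phase_integral yo k" for yo k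
    unfolding checkft_def wave_shift_def wave_profile phase_integral_def s_def[symmetric] s2[symmetric]
    by (simp add: mult.assoc)
  have N: "Nbar (wave_shift po D yo) = (LBINT k:{0<..}. (norm (phase_integral yo k))\<^sup>2 / (2 * k)) / (4 * pi\<^sup>2)" for yo
    unfolding Nbar_def checkft set_lebesgue_integral_def integral_divide_zero[symmetric]
    by (intro Bochner_Integration.integral_cong refl) (simp add: norm_mult norm_divide power_divide power_mult_distrib)
  obtain B where B: "\<And>p. norm (F p) \<le> B" using continuous_compact_support[OF cont supp] by blast
  \<comment> \<open>Inversion recovers the spectrum up to the phase exp (- i p yo), so the thermal
    number is the same for all translations.\<close>
  have fourier: "norm (fourier (wave_shift po D yo) p) = norm (F p)" for yo p
  proof -
    have "(LINT y|lborel. wave po D (y - yo) * cis (- p * y)) = (LINT y|lborel. wave po D y * cis (- p * (yo + y)))"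
      by (subst lborel_integral_real_affine[of 1 _ yo]) auto
    also have "\<dots> = (LINT y|lborel. (s * cis (- p * yo)) * (profile y * cis (- p * y)))"
    proof (intro Bochner_Integration.integral_cong refl)
      fix y
      have "cis (- p * (yo + y)) = cis (- p * yo) * cis (- p * y)"
        by (simp add: cis_mult algebra_simps)
      then show "wave po D y * cis (- p * (yo + y)) = (s * cis (- p * yo)) * (profile y * cis (- p * y))"
        unfolding wave_profile by (simp only: mult_ac)
    qed
    also have "\<dots> = (s * cis (- p * yo)) * (2 * pi * F p)"
      unfolding integral_mult_right_zero profile_def
      by (subst fourier_inversion[OF integrable_F cont B integrable_transform]) simp
    finally have "fourier (wave_shift po D yo) p = (s * s) * cis (- p * yo) * (2 * pi * F p)"
      unfolding fourier_def wave_shift_def s_def[symmetric] by (simp add: mult_ac)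
    then show ?thesis unfolding s2 by (simp add: norm_mult norm_divide)
  qed
  have NTh: "NTh2pi (wave_shift po D yo) = (LINT p|lborel. (norm (weighted_spectrum p))\<^sup>2) / (4 * pi)" for yo
    unfolding NTh2pi_def fourier set_lebesgue_integral_def integral_divide_zero[symmetric] norm_weighted_spectrum_squared
    by simp
  \<comment> \<open>Both terms of the limit agree, as pi / (4 pi^2) = 1 / (4 pi).\<close>
  have "((\<lambda>yo. Nbar (wave_shift po D yo) - NTh2pi (wave_shift po D yo)) \<longlongrightarrow>
      (pi * (LINT p|lborel. (norm (weighted_spectrum p))\<^sup>2)) / (4 * pi\<^sup>2) - (LINT p|lborel. (norm (weighted_spectrum p))\<^sup>2) / (4 * pi)) at_top"
    unfolding N NTh by (intro tendsto_intros N_tendsto_at_top) auto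
  then show "((\<lambda>yo. Nbar (wave_shift po D yo) - NTh2pi (wave_shift po D yo)) \<longlongrightarrow> 0) at_top"
    by (simp add: power2_eq_square)
  have "((\<lambda>yo. Nbar (wave_shift po D yo)) \<longlongrightarrow> 0 / (4 * pi\<^sup>2)) at_bot"
    unfolding N by (intro tendsto_intros N_tendsto_at_bot) auto
  then show "((\<lambda>yo. Nbar (wave_shift po D yo)) \<longlongrightarrow> 0) at_bot" by simp
qed

theorem theorem6:
  fixes po :: real and Dfam :: "real \<Rightarrow> real \<Rightarrow> real"
  assumes "po > 0"
  shows "(\<forall>\<delta> D. 0 < \<delta> \<and> \<delta> \<le> po \<and> admissible po \<delta> D \<longrightarrow>
            ((\<lambda>yo. Nbar (wave_shift po D yo) - NTh2pi (wave_shift po D yo)) \<longlongrightarrow> 0) at_top \<and>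
            ((\<lambda>yo. Nbar (wave_shift po D yo)) \<longlongrightarrow> 0) at_bot)
       \<and> ((\<forall>\<delta>. 0 < \<delta> \<and> \<delta> \<le> po \<longrightarrow> admissible po \<delta> (Dfam \<delta>)) \<longrightarrow>
            ((\<lambda>\<delta>. Lim at_top (\<lambda>yo. Nbar (wave_shift po (Dfam \<delta>) yo)
                                   - NTh2pi (wave_shift po (Dfam \<delta>) yo))) \<longlongrightarrow> 0) (at_right 0) \<and>
            ((\<lambda>\<delta>. Lim at_bot (\<lambda>yo. Nbar (wave_shift po (Dfam \<delta>) yo))) \<longlongrightarrow> 0) (at_right 0))"
proof (intro conjI impI allI)
  fix \<delta> D assume "0 < \<delta> \<and> \<delta> \<le> po \<and> admissible po \<delta> D"
  then show "((\<lambda>yo. Nbar (wave_shift po D yo) - NTh2pi (wave_shift po D yo)) \<longlongrightarrow> 0) at_top"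
    and "((\<lambda>yo. Nbar (wave_shift po D yo)) \<longlongrightarrow> 0) at_bot"
    using Nbar_limits by blast+
next
  assume adm: "\<forall>\<delta>. 0 < \<delta> \<and> \<delta> \<le> po \<longrightarrow> admissible po \<delta> (Dfam \<delta>)"
  have small: "eventually (\<lambda>\<delta>. 0 < \<delta> \<and> \<delta> \<le> po) (at_right (0::real))"
    unfolding eventually_at_right_field using assms by (intro exI[of _ po]) auto
  \<comment> \<open>By uniqueness of limits the inner \<open>Lim\<close> is exactly 0 for each small
    positive \<delta>, so the outer limit is that of an eventually constant function.\<close>
  have "eventually (\<lambda>\<delta>. Lim at_top (\<lambda>yo. Nbar (wave_shift po (Dfam \<delta>) yo)
                                   - NTh2pi (wave_shift po (Dfam \<delta>) yo)) = 0) (at_right 0)"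
    using small by eventually_elim (use adm in \<open>auto intro!: tendsto_Lim Nbar_limits\<close>)
  then show "((\<lambda>\<delta>. Lim at_top (\<lambda>yo. Nbar (wave_shift po (Dfam \<delta>) yo)
                                   - NTh2pi (wave_shift po (Dfam \<delta>) yo))) \<longlongrightarrow> 0) (at_right 0)"
    by (rule tendsto_eventually)
  have "eventually (\<lambda>\<delta>. Lim at_bot (\<lambda>yo. Nbar (wave_shift po (Dfam \<delta>) yo)) = 0) (at_right 0)"
    using small by eventually_elim (use adm in \<open>auto intro!: tendsto_Lim Nbar_limits\<close>)
  then show "((\<lambda>\<delta>. Lim at_bot (\<lambda>yo. Nbar (wave_shift po (Dfam \<delta>) yo))) \<longlongrightarrow> 0) (at_right 0)"
    by (rule tendsto_eventually)
qed

end
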